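(* Consider an environment $(F,B,\alpha)$ as described in the context (background-risk distribution $F$ with density $f$, compact asset menu $B\ni\mathbf 0$, MLR-ordered experiment $\alpha$). Suppose that the density $f$ is log concave, i.e. $\{w\in\mathbb R: f(w)>0\}$ is an interval on which $\log f$ is concave, and that $B$ is an investment menu. Then willingness to pay for information is decreasing with risk aversion: for all $u,v\in U$ such that $u$ is more risk averse than $v$ and both $u$ and $v$ satisfy (ZAZI), one has $M(u)\le M(v)$.
   Context: Environment. $W$ is a real random variable (background wealth) whose CDF $F$ satisfies $\int|w|\,\mathrm dF(w)<\infty$ and admits a density $f:\mathbb R\to\mathbb R_+$. A map is $F$-integrable if it is measurable and $\int|\cdot|\,\mathrm dF<\infty$. $U$ is the set of strictly increasing functions $u:\mathbb R\to\mathbb R$ that are $F$-integrable, absolutely continuous on every bounded interval, and satisfy $\limsup_{m\to\infty}u(m)/m<\infty$. For $u,v\in U$, $v$ is more risk averse than $u$ if $v=\phi\circ u$ for some increasing and (weakly) concave $\phi:\mathbb R\to\mathbb R$ ("increasing" is in the strict sense). Assets. An asset is an $F$-integrable map $b:\mathbb R\to\mathbb R$. $B$ is a set of assets containing the status quo $\mathbf 0$ (the zero map) and compact for the $L^1(F)$ metric. Experiment. $\alpha=(X,(h_w)_{w\in\mathbb R})$ where $X\subset\mathbb R$ is a finite set, each $h_w$ is a probability mass function on $X$, $w\mapsto h_w(x)$ is measurable for each $x\in X$, and $\alpha$ is MLR-ordered: $h_w(x)h_{w'}(x')\ge h_w(x')h_{w'}(x)$ whenever $w\le w'$ and $x\le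 x'$. Every signal has positive probability: $h(x)=\int h_w(x)\,\mathrm dF(w)>0$. The posterior after $x$ has density $f_x(w)=h_w(x)f(w)/h(x)$ and CDF $F_x$. Strategies and willingness to pay. A strategy is $\beta=(\beta_x)_{x\in X}\in B^X$. For $\mu\ge0$, $G^\mu_\beta(m)=\sum_{x\in X}h(x)\int\mathbf 1_{\{w+\beta_x(w)-\mu\le m\}}\,\mathrm dF_x(w)$ is the CDF of terminal wealth. For each $u\in U$, $\mu\ge 0$, the integrals $\int u\,\mathrm dG^\mu_\beta$ exist in $\mathbb R\cup\{-\infty\}$ and $\max_{\beta\in B^X}\int u\,\mathrm dG^\mu_\beta$ is attained. $M(u)\in\mathbb R_+$ is the unique number such that $\max_{\beta}\int u\,\mathrm dG^\mu_\beta<\int u\,\mathrm dF$ for all $\mu>M(u)$ and $\max_{\beta}\int u\,\mathrm dG^\mu_\beta>\int u\,\mathrm dF$ for all $0\le\mu<M(u)$ (such a number exists and is unique). (ZAZI) for $u$: $\mathbf 0\in\arg\max_{b\in B}\int u(w+b(w))\,\mathrm dF(w)$. Investment menu. An investment is an asset $b$ that is nondecreasing. $B$ is an investment menu if each $b\in B$ is an investment and there exist $w^*\in\mathbb R\cup\{\pm\infty\}$ and a complete ordering $\succeq$ of $B$ (a complete transitive binary relation) such that, for all $b,b'\in B$ with $b'\succeq b$: $b'(w)\le b(w)$ for all real $w\le w^*$, and $b'(w)\ge b(w)$ for all real $w\ge w^*$. *)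

theory Defs
  imports "HOL-Probability.Probability"
begin

text \<open>The integral with values in the extended reals. It is meaningful as soon as the positive or
  the negative part of \<open>g\<close> has a finite integral, and it then takes the value minus infinity when the
  negative part does not.\<close>

definition ext_integral :: "'a measure \<Rightarrow> ('a \<Rightarrow> real) \<Rightarrow> ereal" where
  "ext_integral M g =
     enn2ereal (\<integral>\<^sup>+ x. ennreal (g x) \<partial>M) - enn2ereal (\<integral>\<^sup>+ x. ennreal (- g x) \<partial>M)"

text \<open>A pair \<open>(s, t)\<close> stands for the interval from \<open>s\<close> to \<open>t\<close>; the intervals of a family may share
  endpoints.\<close>

definition abs_continuous_fun_on :: "real set \<Rightarrow> (real \<Rightarrow> real) \<Rightarrow> bool" where
  "abs_continuous_fun_on I u \<longleftrightarrow>
     (\<forall>\<epsilon>>0. \<exists>\<delta>>0. \<forall>S :: (real \<times> real) set.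
        finite S \<and> (\<forall>(s, t) \<in> S. s \<le> t \<and> {s..t} \<subseteq> I) \<and>
        disjoint_family_on (\<lambda>(s, t). {s<..<t}) S \<and> (\<Sum>(s, t)\<in>S. t - s) < \<delta>
        \<longrightarrow> (\<Sum>(s, t)\<in>S. \<bar>u t - u s\<bar>) < \<epsilon>)"

text \<open>The law of background wealth, given its density; integrals with respect to the distribution
  function of wealth are integrals with respect to this measure. Since it lives on the Borel sets,
  \<^term>\<open>integrable (wealth_law f) g\<close> includes Borel measurability of \<open>g\<close>.\<close>

definition wealth_law :: "(real \<Rightarrow> real) \<Rightarrow> real measure" where
  "wealth_law f = density lborel (\<lambda>w. ennreal (f w))"

definition wealth_density :: "(real \<Rightarrow> real) \<Rightarrow> bool" where
  "wealth_density f \<longleftrightarrow>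
     f \<in> borel_measurable borel \<and> (\<forall>w. 0 \<le> f w) \<and> prob_space (wealth_law f) \<and>
     integrable (wealth_law f) (\<lambda>w. \<bar>w\<bar>)"

definition log_concave :: "(real \<Rightarrow> real) \<Rightarrow> bool" where
  "log_concave f \<longleftrightarrow>
     is_interval {w. 0 < f w} \<and> concave_on {w. 0 < f w} (\<lambda>w. ln (f w))"

definition utilities :: "(real \<Rightarrow> real) \<Rightarrow> (real \<Rightarrow> real) set" where
  "utilities f =
     {u. strict_mono u \<and> integrable (wealth_law f) u \<and>
         (\<forall>I. is_interval I \<and> bounded I \<longrightarrow> abs_continuous_fun_on I u) \<and>
         Limsup at_top (\<lambda>m. ereal (u m / m)) < \<infinity>}"

definition more_risk_averse :: "(real \<Rightarrow> real) \<Rightarrow> (real \<Rightarrow> real) \<Rightarrow> bool" where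
  "more_risk_averse v u \<longleftrightarrow>
     (\<exists>\<phi> :: real \<Rightarrow> real. strict_mono \<phi> \<and> concave_on UNIV \<phi> \<and> v = \<phi> \<circ> u)"

definition assets :: "(real \<Rightarrow> real) \<Rightarrow> (real \<Rightarrow> real) set" where
  "assets f = {b. integrable (wealth_law f) b}"

text \<open>The topology of the \<open>L\<^sup>1\<close> metric on the set of all assets. Assets that agree almost everywhere
  are not identified, so this is the topology of a pseudometric, which has the same compact sets up
  to null sets.\<close>

definition L1_dist :: "(real \<Rightarrow> real) \<Rightarrow> (real \<Rightarrow> real) \<Rightarrow> (real \<Rightarrow> real) \<Rightarrow> real" where
  "L1_dist f b c = (\<integral>w. \<bar>b w - c w\<bar> \<partial>wealth_law f)"

definition L1_topology :: "(real \<Rightarrow> real) \<Rightarrow> (real \<Rightarrow> real) topology" where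
  "L1_topology f =
     topology_generated_by {{c \<in> assets f. L1_dist f b c < r} | b r. b \<in> assets f}"

definition asset_menu :: "(real \<Rightarrow> real) \<Rightarrow> (real \<Rightarrow> real) set \<Rightarrow> bool" where
  "asset_menu f B \<longleftrightarrow> B \<subseteq> assets f \<and> (\<lambda>_. 0) \<in> B \<and> compactin (L1_topology f) B"

definition investment_menu :: "(real \<Rightarrow> real) set \<Rightarrow> bool" where
  "investment_menu B \<longleftrightarrow>
     (\<forall>b\<in>B. mono b) \<and>
     (\<exists>(wstar :: ereal) (R :: (real \<Rightarrow> real) \<Rightarrow> (real \<Rightarrow> real) \<Rightarrow> bool).
        (\<forall>b\<in>B. \<forall>b'\<in>B. R b' b \<or> R b b') \<and> transp_on B R \<and>
        (\<forall>b\<in>B. \<forall>b'\<in>B. R b' b \<longrightarrow>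
           (\<forall>w. ereal w \<le> wstar \<longrightarrow> b' w \<le> b w) \<and>
           (\<forall>w. wstar \<le> ereal w \<longrightarrow> b w \<le> b' w)))"

definition ZAZI :: "(real \<Rightarrow> real) \<Rightarrow> (real \<Rightarrow> real) set \<Rightarrow> (real \<Rightarrow> real) \<Rightarrow> bool" where
  "ZAZI f B u \<longleftrightarrow>
     is_arg_max (\<lambda>b. ext_integral (wealth_law f) (\<lambda>w. u (w + b w))) (\<lambda>b. b \<in> B) (\<lambda>_. 0)"

definition signal_prob :: "(real \<Rightarrow> real) \<Rightarrow> (real \<Rightarrow> real pmf) \<Rightarrow> real \<Rightarrow> real" where
  "signal_prob f h x = (\<integral>w. pmf (h w) x \<partial>wealth_law f)"

definition signal_experiment :: "(real \<Rightarrow> real) \<Rightarrow> real set \<Rightarrow> (real \<Rightarrow> real pmf) \<Rightarrow> bool" where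
  "signal_experiment f X h \<longleftrightarrow>
     finite X \<and> (\<forall>w. set_pmf (h w) \<subseteq> X) \<and>
     (\<forall>x\<in>X. (\<lambda>w. pmf (h w) x) \<in> borel_measurable borel) \<and>
     (\<forall>w w'. \<forall>x\<in>X. \<forall>x'\<in>X. w \<le> w' \<and> x \<le> x' \<longrightarrow>
        pmf (h w) x * pmf (h w') x' \<ge> pmf (h w) x' * pmf (h w') x) \<and>
     (\<forall>x\<in>X. 0 < signal_prob f h x)"

definition posterior_density ::
    "(real \<Rightarrow> real) \<Rightarrow> (real \<Rightarrow> real pmf) \<Rightarrow> real \<Rightarrow> real \<Rightarrow> real" where
  "posterior_density f h x w = pmf (h w) x * f w / signal_prob f h x"

definition environment ::
    "(real \<Rightarrow> real) \<Rightarrow> (real \<Rightarrow> real) set \<Rightarrow> real set \<Rightarrow> (real \<Rightarrow> real pmf) \<Rightarrow> bool" where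
  "environment f B X h \<longleftrightarrow> wealth_density f \<and> asset_menu f B \<and> signal_experiment f X h"

definition terminal_cdf ::
    "(real \<Rightarrow> real) \<Rightarrow> real set \<Rightarrow> (real \<Rightarrow> real pmf) \<Rightarrow> real \<Rightarrow> (real \<Rightarrow> real \<Rightarrow> real) \<Rightarrow> real \<Rightarrow> real" where
  "terminal_cdf f X h \<mu> \<beta> m =
     (\<Sum>x\<in>X. signal_prob f h x *
        (\<integral>w. indicator {w. w + \<beta> x w - \<mu> \<le> m} w \<partial>wealth_law (posterior_density f h x)))"

text \<open>The greatest element of the set of attainable expected utilities. For \<open>u \<in> utilities f\<close> and
  \<open>\<mu> \<ge> 0\<close> it exists because the menu is \<open>L\<^sup>1\<close>-compact.\<close>

definition max_expected_utility ::
    "(real \<Rightarrow> real) \<Rightarrow> (real \<Rightarrow> real) set \<Rightarrow> real set \<Rightarrow> (real \<Rightarrow> real pmf) \<Rightarrow>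
     (real \<Rightarrow> real) \<Rightarrow> real \<Rightarrow> ereal" where
  "max_expected_utility f B X h u \<mu> =
     (GREATEST y. \<exists>\<beta> \<in> X \<rightarrow>\<^sub>E B.
        y = ext_integral (interval_measure (terminal_cdf f X h \<mu> \<beta>)) u)"

definition willingness_to_pay ::
    "(real \<Rightarrow> real) \<Rightarrow> (real \<Rightarrow> real) set \<Rightarrow> real set \<Rightarrow> (real \<Rightarrow> real pmf) \<Rightarrow>
     (real \<Rightarrow> real) \<Rightarrow> real" where
  "willingness_to_pay f B X h u =
     (THE M. 0 \<le> M \<and>
        (\<forall>\<mu>>M. max_expected_utility f B X h u \<mu> < ext_integral (wealth_law f) u) \<and>
        (\<forall>\<mu>. 0 \<le> \<mu> \<and> \<mu> < M \<longrightarrow>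
           max_expected_utility f B X h u \<mu> > ext_integral (wealth_law f) u))"

end

theory Submission
  imports Defs
begin

text \<open>Let \<open>0 \<le> \<mu> < M(u)\<close>; it suffices that \<open>v\<close> is also willing to pay \<open>\<mu>\<close>. If the pivot \<open>w*\<close> is
  infinite, the menu is a pointwise chain, so by (ZAZI) no asset gains on a non-null set and
  information is worthless. If \<open>w*\<close> is finite, every investment is steeper than \<open>0\<close> around \<open>w*\<close>, and
  by the MLR order \<open>u\<close> has a profitable strategy that chooses steeper investments after higher signals.
  For such a strategy, log concavity makes the law of terminal wealth cross \<open>F\<close> at most once, from
  above. Write \<open>u = \<phi> \<circ> v\<close> and let \<open>c\<close> be a supergradient of \<open>\<phi>\<close> at the crossing point: then
  \<open>u - c v\<close> increases up to the crossing point and decreases after it, so it has a smaller mean under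
  terminal wealth than under \<open>F\<close>, and the gain of \<open>v\<close> is at least \<open>1/c\<close> times the gain of \<open>u\<close>.\<close>

section \<open>Extended integrals and stochastic dominance\<close>

text \<open>Utilities have a linear bound from above but none from below. Expected utility may
  therefore be minus infinity, only its upper semicontinuity in the asset is available, and each
  comparison must first secure integrability. The maximum and the willingness to pay are defined by
  \<open>GREATEST\<close> and \<open>THE\<close>, so their existence is derived here from
  compactness of the menu. The signal probabilities may vanish, so the MLR order need not rank the
  best replies, and an ordered strategy has to be constructed. Log concavity enters because the
  distribution function of wealth plus a gain \<open>s\<close> involves a translate of the density:
  the likelihood ratio of a translate to \<open>f\<close> must be monotone.\<close>

lemma ext_integral_integrable:
  assumes "integrable M g"
  shows "ext_integral M g = ereal (\<integral>x. g x \<partial>M)"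
proof -
  have m[measurable]: "g \<in> borel_measurable M" using assms by auto
  have a: "(\<integral>\<^sup>+ x. ennreal (g x) \<partial>M) \<noteq> \<infinity>" "(\<integral>\<^sup>+ x. ennreal (- g x) \<partial>M) \<noteq> \<infinity>"
    using assms by (auto simp: real_integrable_def)
  have "(\<integral>x. g x \<partial>M) = enn2real (\<integral>\<^sup>+ x. ennreal (g x) \<partial>M) - enn2real (\<integral>\<^sup>+ x. ennreal (- g x) \<partial>M)"
    by (rule real_lebesgue_integral_def[OF assms])
  then show ?thesis
    unfolding ext_integral_def using a
    by (cases "\<integral>\<^sup>+ x. ennreal (g x) \<partial>M" rule: ennreal_cases;
        cases "\<integral>\<^sup>+ x. ennreal (- g x) \<partial>M" rule: ennreal_cases) auto
qed

lemma ext_integral_not_integrable: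
  assumes "g \<in> borel_measurable M" "(\<integral>\<^sup>+ x. ennreal (g x) \<partial>M) < \<infinity>" "\<not> integrable M g"
  shows "ext_integral M g = -\<infinity>"
proof -
  have "(\<integral>\<^sup>+ x. ennreal (- g x) \<partial>M) = \<infinity>"
    using assms by (auto simp: real_integrable_def)
  then show ?thesis
    unfolding ext_integral_def using assms(2)
    by (cases "\<integral>\<^sup>+ x. ennreal (g x) \<partial>M" rule: ennreal_cases) auto
qed

text \<open>All utilities met below have a positive part with finite integral, by linear growth, so
  minus infinity is the only nonreal value that occurs.\<close>

lemma ext_integral_if:
  assumes "g \<in> borel_measurable M" "(\<integral>\<^sup>+ x. ennreal (g x) \<partial>M) < \<infinity>"
  shows "ext_integral M g = (if integrable M g then ereal (\<integral>x. g x \<partial>M) else -\<infinity>)"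
  using ext_integral_integrable ext_integral_not_integrable assms by auto

lemma ext_integral_mono_AE:
  assumes "AE x in M. g x \<le> g' x"
  shows "ext_integral M g \<le> ext_integral M g'"
  unfolding ext_integral_def
proof (intro ereal_minus_mono less_eq_ennreal.rep_eq[THEN iffD1] nn_integral_mono_AE)
  show "AE x in M. ennreal (g x) \<le> ennreal (g' x)" "AE x in M. ennreal (- g' x) \<le> ennreal (- g x)"
    using assms by (eventually_elim; simp add: ennreal_leI)+
qed

lemma ext_integral_mono:
  assumes "\<And>x. g x \<le> g' x"
  shows "ext_integral M g \<le> ext_integral M g'"
  using assms by (intro ext_integral_mono_AE) simp

lemma integrable_sandwich:
  fixes g :: "'a \<Rightarrow> real"
  assumes "integrable M lo" "integrable M hi" "g \<in> borel_measurable M" "\<And>x. lo x \<le> g x" "\<And>x. g x \<le> hi x"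
  shows "integrable M g"
proof (rule Bochner_Integration.integrable_bound)
  show "integrable M (\<lambda>x. \<bar>lo x\<bar> + \<bar>hi x\<bar>)" using assms by auto
  have "\<bar>g x\<bar> \<le> \<bar>lo x\<bar> + \<bar>hi x\<bar>" for x using assms(4)[of x] assms(5)[of x] by linarith
  then show "AE x in M. norm (g x) \<le> norm (\<bar>lo x\<bar> + \<bar>hi x\<bar>)" by simp
qed (rule assms)

lemma nn_integral_finite_of_le:
  fixes g p :: "'a \<Rightarrow> real"
  assumes "integrable M p" "\<And>x. g x \<le> p x"
  shows "(\<integral>\<^sup>+ x. ennreal (g x) \<partial>M) < \<infinity>"
proof -
  have "(\<integral>\<^sup>+ x. ennreal (g x) \<partial>M) \<le> (\<integral>\<^sup>+ x. ennreal (p x) \<partial>M)"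
    by (intro nn_integral_mono ennreal_leI assms)
  also have "\<dots> < \<infinity>" using assms(1) by (auto simp: real_integrable_def less_top)
  finally show ?thesis .
qed

text \<open>This is Fatou's lemma for the nonnegative functions \<open>p' n - g' n\<close>. The
  majorants may vary with \<open>n\<close> as long as their integrals converge; no lower bound on
  the \<open>g' n\<close> is required.\<close>

lemma ext_integral_limit_ge:
  fixes g :: "'a \<Rightarrow> real" and g' :: "nat \<Rightarrow> 'a \<Rightarrow> real"
  assumes [measurable]: "g \<in> borel_measurable M" "\<And>n. g' n \<in> borel_measurable M"
    and ip: "integrable M p" and ip': "\<And>n. integrable M (p' n)"
    and le: "\<And>x. g x \<le> p x" and le': "\<And>n x. g' n x \<le> p' n x"
    and ae: "AE x in M. (\<lambda>n. p' n x - g' n x) \<longlonglongrightarrow> p x - g x"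
    and lim: "(\<lambda>n. \<integral>x. p' n x \<partial>M) \<longlonglongrightarrow> (\<integral>x. p x \<partial>M)"
    and ge: "\<And>n. c \<le> ext_integral M (g' n)"
  shows "c \<le> ext_integral M g"
proof (cases c)
  case MInf then show ?thesis by simp
next
  case PInf
  have "ext_integral M (g' 0) < \<infinity>"
    using ext_integral_if[OF assms(2) nn_integral_finite_of_le[OF ip' le'], of 0] by simp
  then show ?thesis using ge[of 0] PInf by simp
next
  case (real r)
  have [measurable]: "p \<in> borel_measurable M" "\<And>n. p' n \<in> borel_measurable M"
    using ip ip' by auto
  have fin: "ext_integral M (g' n) = (if integrable M (g' n) then ereal (\<integral>x. g' n x \<partial>M) else -\<infinity>)" for n
    by (rule ext_integral_if[OF assms(2) nn_integral_finite_of_le[OF ip' le']])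
  have int: "integrable M (g' n)" and rle: "r \<le> (\<integral>x. g' n x \<partial>M)" for n
    using ge[of n] real unfolding fin by (auto split: if_splits)
  have "(\<integral>\<^sup>+x. ennreal (p x - g x) \<partial>M) = (\<integral>\<^sup>+x. liminf (\<lambda>n. ennreal (p' n x - g' n x)) \<partial>M)"
  proof (rule nn_integral_cong_AE)
    show "AE x in M. ennreal (p x - g x) = liminf (\<lambda>n. ennreal (p' n x - g' n x))"
      using ae
    proof eventually_elim
      case (elim x)
      then have "(\<lambda>n. ennreal (p' n x - g' n x)) \<longlonglongrightarrow> ennreal (p x - g x)"
        by (rule tendsto_ennrealI)
      then show ?case by (rule lim_imp_Liminf[OF sequentially_bot, symmetric])
    qed
  qed
  also have "\<dots> \<le> liminf (\<lambda>n. \<integral>\<^sup>+x. ennreal (p' n x - g' n x) \<partial>M)"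
    by (rule nn_integral_liminf) auto
  also have "\<dots> \<le> liminf (\<lambda>n. ennreal ((\<integral>x. p' n x \<partial>M) - r))"
  proof (rule Liminf_mono, rule always_eventually, rule allI)
    fix n
    have "(\<integral>\<^sup>+x. ennreal (p' n x - g' n x) \<partial>M) = ennreal (\<integral>x. p' n x - g' n x \<partial>M)"
      by (rule nn_integral_eq_integral) (auto intro!: Bochner_Integration.integrable_diff ip' int simp: le')
    also have "\<dots> \<le> ennreal ((\<integral>x. p' n x \<partial>M) - r)"
      using rle[of n] by (intro ennreal_leI) (simp add: Bochner_Integration.integral_diff[OF ip' int])
    finally show "(\<integral>\<^sup>+x. ennreal (p' n x - g' n x) \<partial>M) \<le> ennreal ((\<integral>x. p' n x \<partial>M) - r)" .
  qed
  also have "\<dots> = ennreal ((\<integral>x. p x \<partial>M) - r)"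
    by (intro lim_imp_Liminf[OF sequentially_bot] tendsto_ennrealI tendsto_diff lim tendsto_const)
  finally have bound: "(\<integral>\<^sup>+x. ennreal (p x - g x) \<partial>M) \<le> ennreal ((\<integral>x. p x \<partial>M) - r)" .
  have i: "integrable M (\<lambda>x. p x - g x)"
    by (rule integrableI_nonneg) (use bound le in \<open>auto intro: le_less_trans\<close>)
  have rp: "r \<le> (\<integral>x. p x \<partial>M)"
  proof (rule LIMSEQ_le_const[OF lim])
    show "\<exists>N. \<forall>n\<ge>N. r \<le> (\<integral>x. p' n x \<partial>M)"
      using rle integral_mono[OF int ip' le'] by (meson order_trans)
  qed
  have g: "integrable M g"
    using Bochner_Integration.integrable_diff[OF ip i] by simp
  have "ennreal (\<integral>x. p x - g x \<partial>M) \<le> ennreal ((\<integral>x. p x \<partial>M) - r)"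
    using bound nn_integral_eq_integral[OF i] le by simp
  then have "(\<integral>x. p x - g x \<partial>M) \<le> (\<integral>x. p x \<partial>M) - r"
    using rp by (simp add: ennreal_le_iff)
  then have "r \<le> (\<integral>x. g x \<partial>M)"
    by (simp add: Bochner_Integration.integral_diff[OF ip g])
  then show ?thesis
    using real ext_integral_integrable[OF g] by simp
qed

section \<open>Growth and continuity of utilities\<close>

lemma utilities_linear_growth:
  assumes "u \<in> utilities f"
  obtains C K where "0 \<le> C" "0 \<le> K" "\<And>m. u m \<le> C + K * \<bar>m\<bar>"
proof -
  have sm: "strict_mono u" and L: "Limsup at_top (\<lambda>m. ereal (u m / m)) < \<infinity>"
    using assms by (auto simp: utilities_def)
  obtain k :: real where "Limsup at_top (\<lambda>m. ereal (u m / m)) < ereal k"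
    using less_PInf_Ex_of_nat[of "Limsup at_top (\<lambda>m. ereal (u m / m))"] L by auto
  then have "eventually (\<lambda>m. ereal (u m / m) < ereal k) at_top"
    by (rule Limsup_lessD)
  then obtain N where N: "\<And>m. N \<le> m \<Longrightarrow> u m / m < k"
    by (auto simp: eventually_at_top_linorder)
  \<comment> \<open>The maximum with 1 makes \<open>m\<close> positive, so that the bound on
    \<open>u m / m\<close> can be multiplied out. Below \<open>N'\<close> monotonicity takes
    over.\<close>
  define N' where "N' = max N 1"
  have "u m \<le> \<bar>u N'\<bar> + \<bar>k\<bar> * \<bar>m\<bar>" for m
  proof (cases "N' \<le> m")
    case True
    then have "m > 0" "u m / m < k" using N[of m] by (auto simp: N'_def)
    then have "u m \<le> k * m" by (simp add: divide_simps)
    also have "\<dots> \<le> \<bar>k\<bar> * \<bar>m\<bar>" by (metis abs_ge_self abs_mult)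
    finally show ?thesis by simp
  next
    case False
    then have "u m \<le> u N'" using sm by (simp add: strict_mono_less_eq)
    then show ?thesis
      by (smt (verit) abs_ge_zero mult_nonneg_nonneg)
  qed
  then show ?thesis by (rule that[of "\<bar>u N'\<bar>" "\<bar>k\<bar>", rotated 2]) auto
qed

lemma utilities_continuous:
  assumes "u \<in> utilities f"
  shows "continuous_on UNIV u"
proof -
  have ac: "abs_continuous_fun_on {a..b} u" for a b
    using assms by (auto simp: utilities_def is_interval_cc)
  have "isCont u m" for m
  proof (unfold continuous_at_eps_delta, intro allI impI)
    fix e :: real assume "0 < e"
    obtain d where d: "d > 0" and D: "\<forall>S :: (real \<times> real) set. finite S \<and>
        (\<forall>(s, t) \<in> S. s \<le> t \<and> {s..t} \<subseteq> {m-1..m+1}) \<and>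
        disjoint_family_on (\<lambda>(s, t). {s<..<t}) S \<and> (\<Sum>(s, t)\<in>S. t - s) < d
        \<longrightarrow> (\<Sum>(s, t)\<in>S. \<bar>u t - u s\<bar>) < e"
      using ac[of "m-1" "m+1", unfolded abs_continuous_fun_on_def, THEN spec, THEN mp, OF \<open>0 < e\<close>] by (elim exE conjE)
    show "\<exists>d>0. \<forall>x'. dist x' m < d \<longrightarrow> dist (u x') (u m) < e"
    proof (intro exI[of _ "min d 1"] conjI allI impI)
      fix y assume y: "dist y m < min d 1"
      \<comment> \<open>Absolute continuity is applied to a single interval; the cap 1 on the
        distance keeps it inside \<open>{m-1..m+1}\<close>.\<close>
      have "(\<Sum>(s, t)\<in>{(min y m, max y m)}. \<bar>u t - u s\<bar>) < e"
        by (rule D[THEN spec, THEN mp]) (use y in \<open>auto simp: dist_real_def disjoint_family_on_def\<close>)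
      then show "dist (u y) (u m) < e"
        by (auto simp: dist_real_def min_def max_def split: if_splits)
    qed (use d in simp)
  qed
  then show ?thesis by (simp add: continuous_on_eq_continuous_at)
qed

section \<open>First-order stochastic dominance through the layer cake formula\<close>

lemma nn_integral_layer_cake:
  fixes q :: "'a \<Rightarrow> real"
  assumes "sigma_finite_measure M" and [measurable]: "q \<in> borel_measurable M"
  shows "(\<integral>\<^sup>+ x. ennreal (q x) \<partial>M) = (\<integral>\<^sup>+ t. indicator {0..} t * emeasure M {x \<in> space M. t < q x} \<partial>lborel)"
proof -
  interpret sigma_finite_measure M by fact
  interpret pair_sigma_finite M "lborel :: real measure" ..
  have "(\<integral>\<^sup>+ x. ennreal (q x) \<partial>M) = (\<integral>\<^sup>+ x. (\<integral>\<^sup>+ t. indicator {0..} t * indicator {z. fst z < snd z} (t, q x) \<partial>lborel) \<partial>M)"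
  proof (rule nn_integral_cong)
    fix x
    have "(\<integral>\<^sup>+ t. indicator {0..} t * indicator {z. fst z < snd z} (t, q x) \<partial>lborel)
        = (\<integral>\<^sup>+ t. indicator {0..<q x} t \<partial>lborel)"
      by (intro nn_integral_cong) (auto simp: indicator_def)
    also have "\<dots> = ennreal (q x)" 
      by (cases "0 \<le> q x") (auto simp: ennreal_neg)
    finally show "ennreal (q x) = (\<integral>\<^sup>+ t. indicator {0..} t * indicator {z. fst z < snd z} (t, q x) \<partial>lborel)" ..
  qed
  also have "\<dots> = (\<integral>\<^sup>+ t. (\<integral>\<^sup>+ x. indicator {0..} t * indicator {z. fst z < snd z} (t, q x) \<partial>M) \<partial>lborel)"
    by (rule Fubini'[symmetric]) measurable
  also have "\<dots> = (\<integral>\<^sup>+ t. indicator {0..} t * emeasure M {x \<in> space M. t < q x} \<partial>lborel)"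
  proof (rule nn_integral_cong)
    fix t :: real
    have "(\<integral>\<^sup>+ x. indicator {z. fst z < snd z} (t, q x) \<partial>M) = (\<integral>\<^sup>+ x. indicator {x \<in> space M. t < q x} x \<partial>M)"
      by (intro nn_integral_cong) (auto simp: indicator_def)
    then show "(\<integral>\<^sup>+ x. indicator {0..} t * indicator {z. fst z < snd z} (t, q x) \<partial>M)
       = indicator {0..} t * emeasure M {x \<in> space M. t < q x}"
      by (subst nn_integral_cmult) auto
  qed
  finally show ?thesis .
qed

text \<open>The layer cake formula reduces both claims to probabilities of level sets. The positive
  part needs the sets \<open>t < q x\<close>, complements of those in \<open>dom\<close>; the
  negative part needs the strict sets \<open>q x < t\<close>, which are increasing unions of those
  in \<open>dom\<close>. Dominance is assumed for the sublevel sets of \<open>q\<close> only, so a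
  \<open>q\<close> that is constant on a half line needs no comparison there.\<close>

lemma stochastic_dominance_nn:
  fixes q :: "real \<Rightarrow> real"
  assumes "real_distribution M" "real_distribution N" and [measurable]: "q \<in> borel_measurable borel"
    and dom: "\<And>t. measure N {x. q x \<le> t} \<le> measure M {x. q x \<le> t}"
  shows "(\<integral>\<^sup>+ x. ennreal (q x) \<partial>M) \<le> (\<integral>\<^sup>+ x. ennreal (q x) \<partial>N)"
    and "(\<integral>\<^sup>+ x. ennreal (- q x) \<partial>N) \<le> (\<integral>\<^sup>+ x. ennreal (- q x) \<partial>M)"
proof -
  interpret M: real_distribution M by fact
  interpret N: real_distribution N by fact
  have qM: "q \<in> borel_measurable M" and qN: "q \<in> borel_measurable N" by simp_all
  have sfM: "sigma_finite_measure M" and sfN: "sigma_finite_measure N"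
    by unfold_locales
  have compl: "measure M {x. t < q x} = 1 - measure M {x. q x \<le> t}"
     "measure N {x. t < q x} = 1 - measure N {x. q x \<le> t}" for t
    using M.prob_compl[of "{x. q x \<le> t}"] N.prob_compl[of "{x. q x \<le> t}"]
    by (auto simp: Compl_eq_Diff_UNIV[symmetric] Collect_neg_eq[symmetric] not_le)
  show "(\<integral>\<^sup>+ x. ennreal (q x) \<partial>M) \<le> (\<integral>\<^sup>+ x. ennreal (q x) \<partial>N)"
    unfolding nn_integral_layer_cake[OF sfM qM] nn_integral_layer_cake[OF sfN qN]
    by (intro nn_integral_mono mult_left_mono)
      (simp_all add: M.emeasure_eq_measure N.emeasure_eq_measure compl dom ennreal_leI)
  have lt: "measure N {x. q x < t} \<le> measure M {x. q x < t}" for t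
  proof -
    have eq: "{x. q x < t} = (\<Union>n. {x. q x \<le> t - 1 / Suc n})"
    proof safe
      fix x assume "q x < t"
      then obtain n where "inverse (real (Suc n)) < t - q x" 
        using reals_Archimedean[of "t - q x"] by auto
      then show "x \<in> (\<Union>n. {x. q x \<le> t - 1 / Suc n})"
        by (auto simp: field_simps intro!: exI[of _ n])
    next
      fix x n assume "q x \<le> t - 1 / Suc n"
      moreover have "0 < 1 / real (Suc n)" by simp
      ultimately show "q x < t" by linarith
    qed
    have inc: "incseq (\<lambda>n. {x. q x \<le> t - 1 / Suc n})"
    proof (rule incseq_SucI, safe)
      fix n x assume "q x \<le> t - 1 / real (Suc n)"
      moreover have "1 / real (Suc (Suc n)) \<le> 1 / real (Suc n)" by (simp add: field_simps)
      ultimately show "q x \<le> t - 1 / real (Suc (Suc n))" by linarith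
    qed
    have "(\<lambda>n. measure N {x. q x \<le> t - 1 / Suc n}) \<longlonglongrightarrow> measure N {x. q x < t}"
      unfolding eq using inc by (intro N.finite_Lim_measure_incseq) auto
    moreover have "(\<lambda>n. measure M {x. q x \<le> t - 1 / Suc n}) \<longlonglongrightarrow> measure M {x. q x < t}"
      unfolding eq using inc by (intro M.finite_Lim_measure_incseq) auto
    ultimately show ?thesis by (rule LIMSEQ_le) (auto intro: dom)
  qed
  have "{x. t < - q x} = {x. q x < - t}" for t by auto
  then show "(\<integral>\<^sup>+ x. ennreal (- q x) \<partial>N) \<le> (\<integral>\<^sup>+ x. ennreal (- q x) \<partial>M)"
    unfolding nn_integral_layer_cake[OF sfM borel_measurable_uminus[OF qM]]
      nn_integral_layer_cake[OF sfN borel_measurable_uminus[OF qN]]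
    by (intro nn_integral_mono mult_left_mono)
      (simp_all add: M.emeasure_eq_measure N.emeasure_eq_measure lt ennreal_leI)
qed

lemma stochastic_dominance:
  fixes q :: "real \<Rightarrow> real"
  assumes "real_distribution M" "real_distribution N"
    and M: "integrable M q" and N: "integrable N q" and [measurable]: "q \<in> borel_measurable borel"
    and dom: "\<And>t. measure N {x. q x \<le> t} \<le> measure M {x. q x \<le> t}"
  shows "(\<integral>x. q x \<partial>M) \<le> (\<integral>x. q x \<partial>N)"
proof -
  note a = stochastic_dominance_nn[OF assms(1,2,5) dom]
  have fin: "(\<integral>\<^sup>+ x. ennreal (q x) \<partial>N) < top" "(\<integral>\<^sup>+ x. ennreal (- q x) \<partial>M) < top"
    using M N by (auto simp: real_integrable_def less_top)
  show ?thesis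
    unfolding real_lebesgue_integral_def[OF M] real_lebesgue_integral_def[OF N]
    using enn2real_mono[OF a(1) fin(1)] enn2real_mono[OF a(2) fin(2)] by linarith
qed

section \<open>Single crossing and risk aversion\<close>

text \<open>Applied to sublevel sets of continuous nondecreasing functions, this turns their
  probabilities into values of a distribution function.\<close>

lemma closed_lower_set_real:
  fixes S :: "real set"
  assumes "closed S" "\<And>x y. x \<in> S \<Longrightarrow> y \<le> x \<Longrightarrow> y \<in> S"
  shows "S = {} \<or> S = UNIV \<or> (\<exists>a. S = {..a})"
proof (cases "S = {} \<or> \<not> bdd_above S")
  case True
  then show ?thesis using assms(2) by (metis UNIV_eq_I bdd_above.I linorder_le_cases)
next
  case False
  then have "Sup S \<in> S" using closed_contains_Sup assms(1) by blast
  then have "S = {..Sup S}" using assms(2) False by (auto intro: cSup_upper)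
  then show ?thesis by blast
qed

text \<open>The slope is minus a subgradient of the convex function \<open>- \<phi>\<close>. It is
  positive because \<open>\<phi> (z0 + 1)\<close> exceeds \<open>\<phi> z0\<close> but is at most
  \<open>\<phi> z0 + c\<close>.\<close>

lemma concave_supergradient:
  fixes \<phi> :: "real \<Rightarrow> real"
  assumes "strict_mono \<phi>" "concave_on UNIV \<phi>"
  obtains c where "0 < c" "\<And>z. \<phi> z \<le> \<phi> z0 + c * (z - z0)"
proof -
  have "convex_on UNIV (\<lambda>z. - \<phi> z)" using assms(2) by (simp add: concave_on_def)
  then obtain s where s: "\<And>z. - \<phi> z0 + s * (z - z0) \<le> - \<phi> z"
    using convex_le_Inf_differential[of UNIV "\<lambda>z. - \<phi> z" z0] by auto
  have "\<phi> z0 < \<phi> (z0 + 1)" using assms(1) by (simp add: strict_mono_less)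
  then have "0 < - s" using s[of "z0 + 1"] by simp
  moreover have "\<phi> z \<le> \<phi> z0 + - s * (z - z0)" for z using s[of z] by simp
  ultimately show ?thesis by (rule that)
qed

text \<open>The distribution functions are ordered one way before the crossing point and the other
  way after it. So \<open>g = u - c v\<close> is cut there into two pieces, each constant on the far
  side: a nontrivial sublevel set of a piece is a half line ending where the ordering is the one
  needed.\<close>

lemma single_crossing_preference:
  fixes u v \<phi> :: "real \<Rightarrow> real"
  assumes M: "real_distribution M" and N: "real_distribution N"
    and \<phi>: "strict_mono \<phi>" "concave_on UNIV \<phi>" and u: "u = \<phi> \<circ> v"
    and v: "mono v" and cont: "continuous_on UNIV u" "continuous_on UNIV v"
    and int: "integrable M u" "integrable M v" "integrable N u" "integrable N v"
    and cross: "\<And>m m'. m < m' \<Longrightarrow> cdf M m < cdf N m \<Longrightarrow> cdf M m' \<le> cdf N m'"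
    and low: "\<And>m. m \<le> l \<Longrightarrow> cdf N m \<le> cdf M m"
    and less: "(\<integral>x. u x \<partial>N) < (\<integral>x. u x \<partial>M)"
  shows "(\<integral>x. v x \<partial>N) \<le> (\<integral>x. v x \<partial>M)"
proof -
  interpret M: real_distribution M by fact
  interpret N: real_distribution N by fact
  have m[measurable]: "u \<in> borel_measurable borel" "v \<in> borel_measurable borel"
    using cont by (auto intro: borel_measurable_continuous_onI)
  have sublevel: "{x. q x \<le> t} = {} \<or> {x. q x \<le> t} = UNIV \<or> (\<exists>a. {x. q x \<le> t} = {..a})"
    if "mono q" "continuous_on UNIV q" for q :: "real \<Rightarrow> real" and t
  proof (rule closed_lower_set_real)
    show "closed {x. q x \<le> t}" using that(2) by (intro closed_Collect_le continuous_on_const)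
    show "y \<in> {x. q x \<le> t}" if "x \<in> {x. q x \<le> t}" "y \<le> x" for x y
      using that monoD[OF \<open>mono q\<close> that(2)] by simp
  qed
  have mono_u: "mono u"
    unfolding u using v \<phi>(1) by (auto simp: mono_def strict_mono_less_eq)
  \<comment> \<open>If \<open>S\<close> were empty, \<open>N\<close> would dominate \<open>M\<close>
    stochastically and \<open>u\<close> could not gain. With the lower bound supplied by
    \<open>low\<close>, the infimum of \<open>S\<close> is a real crossing point.\<close>
  define S where "S = {m. cdf M m < cdf N m}"
  have "S \<noteq> {}"
  proof
    assume "S = {}"
    then have le: "cdf N m \<le> cdf M m" for m by (auto simp: S_def not_less)
    have "measure N {x. u x \<le> t} \<le> measure M {x. u x \<le> t}" for t
      using sublevel[OF mono_u cont(1), of t] le M.prob_space N.prob_space by (auto simp: cdf_def)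
    from stochastic_dominance[OF M N int(1,3) m(1) this] less show False by simp
  qed
  have bdd: "bdd_below S" by (rule bdd_belowI[of _ l]) (metis S_def low linorder_le_cases mem_Collect_eq not_le)
  define m0 where "m0 = Inf S"
  have below: "cdf N m \<le> cdf M m" if "m < m0" for m
  proof (rule ccontr)
    assume "\<not> ?thesis"
    then have "m \<in> S" by (simp add: S_def)
    then show False using cInf_lower[OF _ bdd, of m] that by (simp add: m0_def)
  qed
  have above': "cdf M m \<le> cdf N m" if lt: "m0 < m" for m
  proof -
    obtain m' where "m' \<in> S" "m' < m"
      using cInf_lessD[OF \<open>S \<noteq> {}\<close>] lt unfolding m0_def by blast
    then show ?thesis using cross[of m' m] by (simp add: S_def)
  qed
  \<comment> \<open>Beyond \<open>m0\<close> the ordering comes from \<open>cross\<close>; it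
    extends to \<open>m0\<close> itself because both distribution functions are right
    continuous.\<close>
  have above: "cdf M m \<le> cdf N m" if "m0 \<le> m" for m
  proof (cases "m0 < m")
    case False
    have "cdf M m0 \<le> cdf N m0"
    proof (rule tendsto_le[OF _ _ _ eventually_at_right_less[THEN eventually_mono]])
      show "(cdf N \<longlongrightarrow> cdf N m0) (at_right m0)" "(cdf M \<longlongrightarrow> cdf M m0) (at_right m0)"
        using N.cdf_is_right_cont M.cdf_is_right_cont by (simp_all add: continuous_within)
    qed (use above' in auto)
    then show ?thesis using False that by simp
  qed (rule above')
  obtain c where c: "0 < c" "\<And>z. \<phi> z \<le> \<phi> (v m0) + c * (z - v m0)"
    using concave_supergradient[OF \<phi>] by blast
  \<comment> \<open>Removing the slope of the supporting line leaves a concave function with maximum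
    at \<open>v m0\<close>. Concavity makes it rise towards that point from either side, and the
    nondecreasing \<open>v\<close> transfers this to \<open>g\<close> and \<open>m0\<close>.\<close>
  define \<psi> where "\<psi> z = \<phi> z - c * z" for z
  have peak: "\<psi> z \<le> \<psi> (v m0)" for z using c(2)[of z] by (simp add: \<psi>_def algebra_simps)
  have conc: "concave_on UNIV \<psi>"
    using \<phi>(2) unfolding concave_on_iff by (auto simp: \<psi>_def algebra_simps)
  have between: "\<psi> x \<le> \<psi> y" if y: "y \<in> closed_segment x (v m0)" for x y
  proof -
    obtain t where t: "0 \<le> t" "t \<le> 1" "y = (1 - t) * x + t * v m0"
      using y by (auto simp: closed_segment_def)
    have "(1 - t) * \<psi> x + t * \<psi> (v m0) \<le> \<psi> y"
      using concave_onD[OF conc t(1,2), of x "v m0"] t(3) by simp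
    moreover have "t * \<psi> x \<le> t * \<psi> (v m0)" using peak t(1) by (rule mult_left_mono)
    ultimately show ?thesis by (simp add: algebra_simps)
  qed
  define g where "g x = u x - c * v x" for x
  have g\<psi>: "g x = \<psi> (v x)" for x by (simp add: g_def \<psi>_def u)
  have inc: "g x \<le> g y" if "x \<le> y" "y \<le> m0" for x y
    unfolding g\<psi> using monoD[OF v that(1)] monoD[OF v that(2)]
    by (intro between) (simp add: closed_segment_eq_real_ivl)
  have dec: "g y \<le> g x" if "x \<le> y" "m0 \<le> x" for x y
    unfolding g\<psi> using monoD[OF v that(1)] monoD[OF v that(2)]
    by (intro between) (simp add: closed_segment_eq_real_ivl)
  have cg: "continuous_on UNIV g"
    unfolding g_def by (intro continuous_intros cont)
  have gi: "integrable M g" "integrable N g"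
    unfolding g_def using int by auto
  define q1 where "q1 x = g (min x m0)" for x
  define q2 where "q2 x = - g (max x m0)" for x
  have q1: "mono q1" "continuous_on UNIV q1"
    by (auto simp: q1_def intro!: monoI inc continuous_intros continuous_on_compose2[OF cg])
  have q2: "mono q2" "continuous_on UNIV q2"
    by (auto simp: q2_def intro!: monoI dec continuous_intros continuous_on_compose2[OF cg])
  have qm[measurable]: "q1 \<in> borel_measurable borel" "q2 \<in> borel_measurable borel"
    using q1 q2 by (auto intro: borel_measurable_continuous_onI)
  have qi: "integrable L q1" "integrable L q2" if "integrable L g" "real_distribution L" for L
  proof -
    interpret L: real_distribution L by fact
    have "integrable L (\<lambda>x. \<bar>g x\<bar> + \<bar>g m0\<bar>)" using that(1) by auto
    then show "integrable L q1" "integrable L q2"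
      by (rule Bochner_Integration.integrable_bound; simp add: q1_def q2_def min_def max_def)+
  qed
  have q1_le: "(\<integral>x. q1 x \<partial>M) \<le> (\<integral>x. q1 x \<partial>N)"
  proof (rule stochastic_dominance[OF M N qi(1)[OF gi(1) M] qi(1)[OF gi(2) N] qm(1)])
    fix t
    show "measure N {x. q1 x \<le> t} \<le> measure M {x. q1 x \<le> t}"
    proof (cases "q1 m0 \<le> t")
      case True
      \<comment> \<open>Since \<open>q1 m0\<close> is the maximum of \<open>q1\<close>, a level
        above it gives the whole line; a lower level gives a half line ending strictly before
        \<open>m0\<close>.\<close>
      have "q1 x \<le> q1 m0" for x using inc[of "min x m0" m0] by (simp add: q1_def)
      then have "q1 x \<le> t" for x using True by (meson order_trans)
      then have "{x. q1 x \<le> t} = UNIV" by simp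
      then show ?thesis using M.prob_space N.prob_space by simp
    next
      case False
      with sublevel[OF q1, of t] show ?thesis
      proof (elim disjE exE)
        fix a assume a: "{x. q1 x \<le> t} = {..a}"
        then have "a < m0" using False by (metis atMost_iff mem_Collect_eq not_le)
        then show ?thesis using below unfolding a by (simp add: cdf_def)
      qed auto
    qed
  qed
  have q2_le: "(\<integral>x. q2 x \<partial>N) \<le> (\<integral>x. q2 x \<partial>M)"
  proof (rule stochastic_dominance[OF N M qi(2)[OF gi(2) N] qi(2)[OF gi(1) M] qm(2)])
    fix t
    show "measure M {x. q2 x \<le> t} \<le> measure N {x. q2 x \<le> t}"
    proof (cases "q2 m0 \<le> t")
      case False
      have "q2 m0 \<le> q2 x" for x using dec[of m0 "max x m0"] by (simp add: q2_def)
      then have "\<not> q2 x \<le> t" for x using False by (meson order_trans)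
      then have "{x. q2 x \<le> t} = {}" by simp
      then show ?thesis by simp
    next
      case True
      with sublevel[OF q2, of t] show ?thesis
      proof (elim disjE exE)
        fix a assume a: "{x. q2 x \<le> t} = {..a}"
        then have "m0 \<le> a" using True by blast
        then show ?thesis using above unfolding a by (simp add: cdf_def)
      qed (use M.prob_space N.prob_space in auto)
    qed
  qed
  have "(\<integral>x. g x \<partial>L) = (\<integral>x. q1 x \<partial>L) - (\<integral>x. q2 x \<partial>L) - g m0"
    if "integrable L g" and L: "real_distribution L" for L
  proof -
    interpret L: real_distribution L by fact
    have "(\<integral>x. g x \<partial>L) = (\<integral>x. q1 x - q2 x - g m0 \<partial>L)"
      by (rule Bochner_Integration.integral_cong) (auto simp: q1_def q2_def min_def max_def)
    also have "\<dots> = (\<integral>x. q1 x - q2 x \<partial>L) - (\<integral>x. g m0 \<partial>L)"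
      using qi[OF that] by (intro Bochner_Integration.integral_diff) auto
    also have "(\<integral>x. q1 x - q2 x \<partial>L) = (\<integral>x. q1 x \<partial>L) - (\<integral>x. q2 x \<partial>L)"
      using qi[OF that] by (rule Bochner_Integration.integral_diff)
    also have "(\<integral>x. g m0 \<partial>L) = g m0" using L.prob_space by simp
    finally show ?thesis .
  qed
  from this[OF gi(1) M] this[OF gi(2) N]
  have diff: "(\<integral>x. g x \<partial>M) - (\<integral>x. g x \<partial>N) = (\<integral>x. q1 x \<partial>M) - (\<integral>x. q1 x \<partial>N) - ((\<integral>x. q2 x \<partial>M) - (\<integral>x. q2 x \<partial>N))"
    by simp
  with q1_le q2_le have "(\<integral>x. g x \<partial>M) \<le> (\<integral>x. g x \<partial>N)" by linarith
  then have "(\<integral>x. u x \<partial>M) - c * (\<integral>x. v x \<partial>M) \<le> (\<integral>x. u x \<partial>N) - c * (\<integral>x. v x \<partial>N)"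
    unfolding g_def using int by simp
  then have "c * (\<integral>x. v x \<partial>N) < c * (\<integral>x. v x \<partial>M)" using less by linarith
  then show ?thesis using c(1) by simp
qed

section \<open>Consequences of log concavity and of the MLR order\<close>

lemma log_concave_four_points:
  assumes lc: "log_concave f" and nn: "\<And>w. 0 \<le> f w"
    and "a \<le> b" "a \<le> c" "a + d = b + c"
  shows "f a * f d \<le> f b * f (c :: real)"
proof (cases "f a = 0 \<or> f d = 0 \<or> a = d")
  case True
  moreover have "b = a \<and> c = a" if "a = d" using that assms by linarith
  ultimately show ?thesis using nn by auto
next
  case False
  then have pos: "0 < f a" "0 < f d" using nn[of a] nn[of d] by auto
  have ad: "a < d" using assms False by linarith
  \<comment> \<open>As \<open>a + d = b + c\<close>, the inner points are convex combinations of the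
    outer ones with complementary weights. Adding the two concavity inequalities makes the weights
    cancel.\<close>
  define t where "t = (b - a) / (d - a)"
  have t: "0 \<le> t" "t \<le> 1" using assms ad by (auto simp: t_def divide_simps)
  have "t * (d - a) = b - a" using ad by (simp add: t_def)
  then have b: "b = (1 - t) * a + t * d" by (simp add: algebra_simps)
  then have c: "c = (1 - (1 - t)) * a + (1 - t) * d" using assms(5) by (simp add: algebra_simps)
  have conc: "concave_on {w. 0 < f w} (\<lambda>w. ln (f w))" and iv: "is_interval {w. 0 < f w}"
    using lc by (auto simp: log_concave_def)
  have in_S: "b \<in> {w. 0 < f w}" "c \<in> {w. 0 < f w}"
    by (rule mem_is_interval_1_I[OF iv, of a d]; use pos assms in auto)+
  have *: "(1 - s) * ln (f a) + s * ln (f d) \<le> ln (f ((1 - s) * a + s * d))" if "0 \<le> s" "s \<le> 1" for s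
    using concave_onD[OF conc that, of a d] pos by simp
  have "ln (f a) + ln (f d) \<le> ln (f b) + ln (f c)"
    using *[of t] *[of "1 - t"] t unfolding b[symmetric] c[symmetric] by (simp add: algebra_simps)
  then have "ln (f a * f d) \<le> ln (f b * f c)"
    using pos in_S by (simp add: ln_mult_pos)
  then show ?thesis using pos in_S by simp
qed

text \<open>Sum the MLR inequality over all pairs with one signal outside \<open>U\<close> and one
  inside. With p and q the probabilities of \<open>U\<close> at \<open>w\<close> and
  \<open>w'\<close>, this reads (1 - q) p \<le> (1 - p) q, that is, p \<le> q.\<close>

lemma MLR_upper_set:
  assumes se: "signal_experiment f X h" and "w \<le> w'" and U: "U \<subseteq> X"
    and up: "\<And>x x'. x \<in> U \<Longrightarrow> x' \<in> X \<Longrightarrow> x \<le> x' \<Longrightarrow> x' \<in> U"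
  shows "(\<Sum>x\<in>U. pmf (h w) x) \<le> (\<Sum>x\<in>U. pmf (h w') x)"
proof -
  have fin: "finite X" and mlr: "\<And>x x'. x \<in> X \<Longrightarrow> x' \<in> X \<Longrightarrow> x \<le> x' \<Longrightarrow>
       pmf (h w) x' * pmf (h w') x \<le> pmf (h w) x * pmf (h w') x'"
    using se \<open>w \<le> w'\<close> unfolding signal_experiment_def by blast+
  have one: "(\<Sum>x\<in>X. pmf (h w) x) = 1" for w
    using se by (intro sum_pmf_eq_1) (auto simp: signal_experiment_def)
  have split: "(\<Sum>x\<in>X - U. pmf (h w) x) = 1 - (\<Sum>x\<in>U. pmf (h w) x)" for w
    using sum_diff[OF fin U, of "pmf (h w)"] one by simp
  have "(\<Sum>x\<in>X - U. pmf (h w') x) * (\<Sum>x'\<in>U. pmf (h w) x')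
      \<le> (\<Sum>x\<in>X - U. pmf (h w) x) * (\<Sum>x'\<in>U. pmf (h w') x')"
    unfolding sum_product
  proof (intro sum_mono)
    fix x x' assume "x \<in> X - U" "x' \<in> U"
    then show "pmf (h w') x * pmf (h w) x' \<le> pmf (h w) x * pmf (h w') x'"
      using mlr[of x x'] up[of x' x] U linear[of x x'] by (auto simp: mult.commute)
  qed
  then show ?thesis unfolding split by (simp add: algebra_simps)
qed

text \<open>The selection is greedy and minimal. Its invariant: whenever \<open>c\<close> lies below the selected value at
  \<open>x\<close>, some earlier index \<open>i\<close> forced the selection above \<open>c\<close> because \<open>c \<notin> A i\<close>.\<close>

lemma monotone_selection:
  fixes A :: "'a::linorder \<Rightarrow> 'b::linorder set"
  assumes "finite X" and "\<And>x. x \<in> X \<Longrightarrow> finite (A x) \<and> A x \<noteq> {}"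
    and "\<And>x y b c. x \<in> X \<Longrightarrow> y \<in> X \<Longrightarrow> x < y \<Longrightarrow> b \<in> A x \<Longrightarrow> c \<in> A y \<Longrightarrow> c < b \<Longrightarrow> b \<in> A y \<or> c \<in> A x"
  obtains s where "\<And>x. x \<in> X \<Longrightarrow> s x \<in> A x" "\<And>x y. x \<in> X \<Longrightarrow> y \<in> X \<Longrightarrow> x \<le> y \<Longrightarrow> s x \<le> s y"
proof -
  have "\<exists>s. (\<forall>x\<in>X. s x \<in> A x) \<and> (\<forall>x\<in>X. \<forall>y\<in>X. x \<le> y \<longrightarrow> s x \<le> s y) \<and>
      (\<forall>x\<in>X. \<forall>c. c < s x \<longrightarrow> (\<exists>i\<in>X. i \<le> x \<and> c < s i \<and> c \<notin> A i))"
    using assms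
  proof (induction X rule: finite_linorder_max_induct)
    case empty
    then show ?case by simp
  next
    case (insert l X)
    obtain s where s: "\<forall>x\<in>X. s x \<in> A x" "\<forall>x\<in>X. \<forall>y\<in>X. x \<le> y \<longrightarrow> s x \<le> s y"
        "\<forall>x\<in>X. \<forall>c. c < s x \<longrightarrow> (\<exists>i\<in>X. i \<le> x \<and> c < s i \<and> c \<notin> A i)"
    proof (atomize_elim, rule insert.IH)
      show "finite (A x) \<and> A x \<noteq> {}" if "x \<in> X" for x using insert.prems(1) that by blast
      show "b \<in> A y \<or> c \<in> A x" if "x \<in> X" "y \<in> X" "x < y" "b \<in> A x" "c \<in> A y" "c < b" for x y b c
        using insert.prems(2)[of x y b c] that by blast
    qed
    have l: "finite (A l)" "A l \<noteq> {}" "l \<notin> X" using insert by auto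
    define L where "L = {a \<in> A l. \<forall>x\<in>X. s x \<le> a}"
    \<comment> \<open>If some \<open>s x\<close> exceeded \<open>Max (A l)\<close>, the invariant
      would give an \<open>i\<close> with \<open>s i\<close> above it and \<open>Max (A l)\<close>
      outside \<open>A i\<close>. The exchange hypothesis would then put \<open>s i\<close> into
      \<open>A l\<close>, beyond its maximum.\<close>
    have "Max (A l) \<in> L"
    proof (rule ccontr)
      assume "Max (A l) \<notin> L"
      then obtain x where "x \<in> X" "Max (A l) < s x"
        using Max_in[OF l(1,2)] by (auto simp: L_def not_le)
      then obtain i where i: "i \<in> X" "Max (A l) < s i" "Max (A l) \<notin> A i" using s(3) by blast
      then have "s i \<in> A l"
        using insert.prems(2)[of i l "s i" "Max (A l)"] s(1) insert.hyps(2) Max_in[OF l(1,2)] by auto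
      then show False using Max_ge[OF l(1)] i(2) by (meson not_le)
    qed
    moreover have "finite L" using l by (simp add: L_def)
    ultimately have MinL: "Min L \<in> L" "\<And>a. a \<in> L \<Longrightarrow> Min L \<le> a" by (auto intro: Min_in)
    let ?s = "s(l := Min L)"
    have "\<exists>i\<in>insert l X. i \<le> l \<and> c < ?s i \<and> c \<notin> A i" if "c < Min L" for c
    \<comment> \<open>There are two reasons for \<open>c\<close> to lie below the new value: either
      \<open>c\<close> is not in \<open>A l\<close>, and \<open>l\<close> itself is the witness, or
      \<open>c\<close> breaks monotonicity against an earlier index, which passes on its own
      witness.\<close>
    proof (cases "c \<in> A l")
      case True
      have "c \<notin> L" using MinL(2)[of c] that by auto
      then obtain x where "x \<in> X" "c < s x" using True by (auto simp: L_def not_le)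
      then obtain i where "i \<in> X" "c < s i" "c \<notin> A i" using s(3) by blast
      then show ?thesis using insert.hyps(2) l(3) by (auto intro!: bexI[of _ i])
    qed (use that in auto)
    moreover have "\<exists>i\<in>insert l X. i \<le> x \<and> c < ?s i \<and> c \<notin> A i" if "x \<in> X" "c < s x" for x c
    proof -
      obtain i where "i \<in> X" "i \<le> x" "c < s i" "c \<notin> A i" using s(3) \<open>x \<in> X\<close> \<open>c < s x\<close> by blast
      then show ?thesis using l(3) by (auto intro!: bexI[of _ i])
    qed
    moreover have "\<forall>x\<in>insert l X. ?s x \<in> A x" using s(1) MinL(1) l(3) by (auto simp: L_def)
    moreover have "\<forall>x\<in>insert l X. \<forall>y\<in>insert l X. x \<le> y \<longrightarrow> ?s x \<le> ?s y"
      using s(2) MinL(1) l(3) insert.hyps(2) by (auto simp: L_def dest: leD)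
    ultimately show ?case using l(3) by (intro exI[of _ ?s]) auto
  qed
  then obtain s where "\<forall>x\<in>X. s x \<in> A x" "\<forall>x\<in>X. \<forall>y\<in>X. x \<le> y \<longrightarrow> s x \<le> s y"
    by (elim exE conjE)
  then show ?thesis by (intro that[of s]) simp_all
qed

text \<open>Only a strict preference for \<open>ub\<close> under \<open>k\<close> carries over to \<open>k'\<close>: if \<open>k\<close> vanishes wherever
  \<open>ub\<close> and \<open>uc\<close> differ, the MLR order says nothing about \<open>k'\<close>. The best replies
  to the signals are therefore not monotone in the strong set order.\<close>

lemma single_crossing_exchange:
  fixes k k' :: "real \<Rightarrow> real" and ub uc :: "real \<Rightarrow> real"
  assumes [measurable]: "k \<in> borel_measurable M" "k' \<in> borel_measurable M"
      "ub \<in> borel_measurable M" "uc \<in> borel_measurable M"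
    and fin: "finite_measure M"
    and k: "\<And>w. 0 \<le> k w" "\<And>w. k w \<le> 1" and k': "\<And>w. 0 \<le> k' w" "\<And>w. k' w \<le> 1"
    and mlr: "\<And>w y. w \<le> y \<Longrightarrow> k' w * k y \<le> k w * k' y"
    and cross: "\<And>w. w \<le> z \<Longrightarrow> ub w \<le> uc w" "\<And>w. z \<le> w \<Longrightarrow> uc w \<le> ub w"
    and bound: "\<And>w. z \<le> w \<Longrightarrow> l \<le> uc w" and p: "integrable M p" "\<And>w. ub w \<le> p w" "\<And>w. uc w \<le> p w"
    and int: "integrable M (\<lambda>w. k w * ub w)" "integrable M (\<lambda>w. k' w * uc w)"
    and pref: "integrable M (\<lambda>w. k w * uc w) \<Longrightarrow> (\<integral>w. k w * uc w \<partial>M) < (\<integral>w. k w * ub w \<partial>M)"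
  shows "integrable M (\<lambda>w. k' w * ub w) \<and> (\<integral>w. k' w * uc w \<partial>M) \<le> (\<integral>w. k' w * ub w \<partial>M)"
proof -
  interpret finite_measure M by fact
  \<comment> \<open>These are the negative and positive parts of \<open>ub - uc\<close>; by
    \<open>cross\<close> the first vanishes on the right of \<open>z\<close> and the second on the
    left.\<close>
  define a where "a w = max 0 (uc w - ub w)" for w
  define d where "d w = max 0 (ub w - uc w)" for w
  have [measurable]: "a \<in> borel_measurable M" "d \<in> borel_measurable M"
    unfolding a_def d_def by auto
  have ad: "ub w = uc w - a w + d w" for w by (simp add: a_def d_def max_def)
  have nn: "0 \<le> a w" "0 \<le> d w" for w by (auto simp: a_def d_def)
  have int_d: "integrable M (\<lambda>w. j w * d w)"
    if [measurable]: "j \<in> borel_measurable M" and "\<And>w. 0 \<le> j w" "\<And>w. j w \<le> 1" for j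
  proof (rule Bochner_Integration.integrable_bound)
    show "integrable M (\<lambda>w. \<bar>p w\<bar> + \<bar>l\<bar>)" using p(1) by auto
    have "j w * d w \<le> \<bar>p w\<bar> + \<bar>l\<bar>" for w
    proof -
      have "d w \<le> \<bar>p w\<bar> + \<bar>l\<bar>"
      proof (cases "z \<le> w")
        case True
        then show ?thesis using bound[of w] p(2)[of w] by (auto simp: d_def)
      next
        case False
        then show ?thesis using cross(1)[of w] by (auto simp: d_def)
      qed
      then show ?thesis using mult_right_mono[OF that(3) nn(2), of w w] by simp
    qed
    then show "AE w in M. norm (j w * d w) \<le> norm (\<bar>p w\<bar> + \<bar>l\<bar>)"
      using that nn by (auto simp: abs_mult)
  qed auto
  note D = int_d[OF assms(1) k] and D' = int_d[OF assms(2) k']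
  have A: "integrable M (\<lambda>w. k w * a w)"
  proof (rule Bochner_Integration.integrable_bound)
    show "integrable M (\<lambda>w. \<bar>p w\<bar> + \<bar>k w * ub w\<bar>)" using p(1) int(1) by auto
    have "k w * a w \<le> \<bar>p w\<bar> + \<bar>k w * ub w\<bar>" for w
    proof -
      have "k w * uc w \<le> k w * p w" using p(3) k(1) by (rule mult_left_mono)
      moreover have "k w * p w \<le> k w * \<bar>p w\<bar>" "k w * \<bar>p w\<bar> \<le> 1 * \<bar>p w\<bar>"
        by (rule mult_left_mono mult_right_mono; use k in simp)+
      ultimately show ?thesis by (auto simp: a_def max_def right_diff_distrib)
    qed
    then show "AE w in M. norm (k w * a w) \<le> norm (\<bar>p w\<bar> + \<bar>k w * ub w\<bar>)"
      using k nn by (auto simp: abs_mult)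
  qed auto
  \<comment> \<open>The premise of \<open>pref\<close> is discharged here: \<open>k w * uc w\<close>
    is a combination of functions already known to be integrable.\<close>
  have "(\<lambda>w. k w * uc w) = (\<lambda>w. k w * ub w + k w * a w - k w * d w)"
    by (auto simp: ad algebra_simps)
  then have "integrable M (\<lambda>w. k w * uc w)"
    and "(\<integral>w. k w * uc w \<partial>M) = (\<integral>w. k w * ub w \<partial>M) + (\<integral>w. k w * a w \<partial>M) - (\<integral>w. k w * d w \<partial>M)"
    using int(1) A D by simp_all
  with pref have less: "(\<integral>w. k w * a w \<partial>M) < (\<integral>w. k w * d w \<partial>M)" by simp
  \<comment> \<open>Write A, D, A', D' for the four integrals. The MLR order, applied to pairs on
    opposite sides of \<open>z\<close>, gives A' D \<le> A D', and A < D then yields A' \<le> D'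
    after cancelling D. Nonnegative integrals are used because finiteness of A' is itself part of
    the claim.\<close>
  let ?A = "\<integral>\<^sup>+w. ennreal (k w * a w) \<partial>M" and ?D = "\<integral>\<^sup>+w. ennreal (k w * d w) \<partial>M"
  let ?A' = "\<integral>\<^sup>+w. ennreal (k' w * a w) \<partial>M" and ?D' = "\<integral>\<^sup>+w. ennreal (k' w * d w) \<partial>M"
  have eqs: "?A = ennreal (\<integral>w. k w * a w \<partial>M)" "?D = ennreal (\<integral>w. k w * d w \<partial>M)"
      "?D' = ennreal (\<integral>w. k' w * d w \<partial>M)"
    using A D D' nn k k' by (auto intro!: nn_integral_eq_integral)
  have "?A' * ?D = (\<integral>\<^sup>+w. \<integral>\<^sup>+y. ennreal (k' w * a w) * ennreal (k y * d y) \<partial>M \<partial>M)"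
    by (simp add: nn_integral_cmult nn_integral_multc)
  also have "\<dots> \<le> (\<integral>\<^sup>+w. \<integral>\<^sup>+y. ennreal (k w * a w) * ennreal (k' y * d y) \<partial>M \<partial>M)"
  proof (intro nn_integral_mono)
    fix w y
    show "ennreal (k' w * a w) * ennreal (k y * d y) \<le> ennreal (k w * a w) * ennreal (k' y * d y)"
    proof (cases "a w = 0 \<or> d y = 0")
      case False
      then have "w < z" "z < y"
        using cross(2)[of w] cross(1)[of y] by (auto simp: a_def d_def max_def not_le[symmetric] split: if_splits)
      then have "k' w * k y * (a w * d y) \<le> k w * k' y * (a w * d y)"
        using nn by (intro mult_right_mono mlr) auto
      then show ?thesis
        using nn k k' by (simp add: ennreal_mult''[symmetric] mult_ac)
    qed auto
  qed
  also have "\<dots> = ?A * ?D'"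
    by (simp add: nn_integral_cmult nn_integral_multc)
  also have "\<dots> \<le> ?D * ?D'"
    using less by (intro mult_right_mono) (auto simp: eqs intro!: ennreal_leI)
  finally have "?A' * ?D \<le> ?D' * ?D" by (simp add: mult.commute)
  moreover have "?D \<noteq> 0" "?D \<noteq> top"
  proof -
    have "0 \<le> (\<integral>w. k w * a w \<partial>M)" using nn k by (intro integral_nonneg_AE) auto
    then show "?D \<noteq> 0" "?D \<noteq> top" unfolding eqs using less by auto
  qed
  ultimately have le: "?A' \<le> ?D'"
    using ennreal_mult_le_mult_iff[of ?D ?A' ?D'] by (simp add: mult.commute)
  have "?A' < \<infinity>" using le_less_trans[OF le] by (simp add: eqs)
  then have A': "integrable M (\<lambda>w. k' w * a w)"
    using nn k' by (intro integrableI_nonneg) auto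
  have "ennreal (\<integral>w. k' w * a w \<partial>M) \<le> ennreal (\<integral>w. k' w * d w \<partial>M)"
    using le nn_integral_eq_integral[OF A'] nn k' by (simp add: eqs)
  then have le': "(\<integral>w. k' w * a w \<partial>M) \<le> (\<integral>w. k' w * d w \<partial>M)"
    using nn k' by (subst (asm) ennreal_le_iff) (auto intro!: integral_nonneg_AE)
  have "(\<lambda>w. k' w * ub w) = (\<lambda>w. k' w * uc w - k' w * a w + k' w * d w)"
    by (auto simp: ad algebra_simps)
  then have "integrable M (\<lambda>w. k' w * ub w)"
    and "(\<integral>w. k' w * ub w \<partial>M) = (\<integral>w. k' w * uc w \<partial>M) - (\<integral>w. k' w * a w \<partial>M) + (\<integral>w. k' w * d w \<partial>M)"
    using int(2) A' D' by simp_all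
  then show ?thesis using le' by simp
qed

section \<open>The law of terminal wealth\<close>

text \<open>Finiteness of the minuends rules out infinity minus infinity, the only obstacle to
  splitting the difference of sums.\<close>

lemma sum_enn2ereal_diff:
  assumes "finite X" "\<And>x. x \<in> X \<Longrightarrow> p x < (\<infinity> :: ennreal)"
  shows "enn2ereal (\<Sum>x\<in>X. p x) - enn2ereal (\<Sum>x\<in>X. n x) = (\<Sum>x\<in>X. enn2ereal (p x) - enn2ereal (n x))"
  using assms
proof (induction X rule: finite_induct)
  case (insert a X)
  have 1: "p a < \<infinity>" "(\<Sum>x\<in>X. p x) < \<infinity>" using insert.prems insert.hyps(1) by (simp_all add: ennreal_sum_less_top)
  have "enn2ereal (p a + P) - enn2ereal (n a + N) = (enn2ereal (p a) - enn2ereal (n a)) + (enn2ereal P - enn2ereal N)"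
    if "P < \<infinity>" for P N
    using 1(1) that
    by (cases "p a" rule: ennreal_cases; cases P rule: ennreal_cases; cases "n a" rule: ennreal_cases;
        cases N rule: ennreal_cases) (auto simp: plus_ennreal.rep_eq)
  then show ?case using insert 1 by simp
qed simp

text \<open>The joint law of signal and wealth, pushed forward to terminal wealth. As an image
  measure it reduces integrals to integrals over wealth, one for each signal.\<close>

definition terminal_law ::
    "(real \<Rightarrow> real) \<Rightarrow> real set \<Rightarrow> (real \<Rightarrow> real pmf) \<Rightarrow> real \<Rightarrow> (real \<Rightarrow> real \<Rightarrow> real) \<Rightarrow> real measure" where
  "terminal_law f X h \<mu> \<beta> =
     distr (density (count_space X \<Otimes>\<^sub>M wealth_law f) (\<lambda>(x, w). ennreal (pmf (h w) x)))
       borel (\<lambda>(x, w). w + \<beta> x w - \<mu>)"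

text \<open>Since \<open>pmf (h w) x * f w\<close> is the posterior density times the probability of
  \<open>x\<close>, this is posterior expected utility weighted by that probability; the values of a
  strategy simply add up over the signals.\<close>

definition signal_value ::
    "(real \<Rightarrow> real) \<Rightarrow> (real \<Rightarrow> real pmf) \<Rightarrow> (real \<Rightarrow> real) \<Rightarrow> real \<Rightarrow> real \<Rightarrow> (real \<Rightarrow> real) \<Rightarrow> ereal" where
  "signal_value f h u \<mu> x b = ext_integral (wealth_law f) (\<lambda>w. pmf (h w) x * u (w + b w - \<mu>))"

locale risky_environment =
  fixes f :: "real \<Rightarrow> real" and B :: "(real \<Rightarrow> real) set" and X :: "real set" and h :: "real \<Rightarrow> real pmf"
  assumes env: "environment f B X h"
begin

abbreviation "P \<equiv> wealth_law f"
abbreviation "val \<equiv> signal_value f h"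
abbreviation "law \<equiv> terminal_law f X h"
abbreviation "maxU \<equiv> max_expected_utility f B X h"
abbreviation "wtp \<equiv> willingness_to_pay f B X h"

lemma is_experiment: "signal_experiment f X h"
  using env by (simp add: environment_def)

lemma sets_P [measurable_cong, simp]: "sets P = sets borel"
  and space_P [simp]: "space P = UNIV"
  by (simp_all add: wealth_law_def)

lemma prob_P: "prob_space P"
  using env by (auto simp: environment_def wealth_density_def)

lemma distribution_P: "real_distribution P"
  using prob_P by (simp add: real_distribution_def real_distribution_axioms_def)

sublocale P: real_distribution P
  by (rule distribution_P)

lemma finite_X: "finite X" and pmf_measurable: "x \<in> X \<Longrightarrow> (\<lambda>w. pmf (h w) x) \<in> borel_measurable borel"
  and signal_prob_pos: "x \<in> X \<Longrightarrow> 0 < signal_prob f h x"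
  using is_experiment by (auto simp: signal_experiment_def)

lemma sum_pmf: "(\<Sum>x\<in>X. pmf (h w) x) = 1"
  using is_experiment by (intro sum_pmf_eq_1) (auto simp: signal_experiment_def)

lemma integrable_wealth: "integrable P (\<lambda>w. w)"
proof -
  have "integrable P (\<lambda>w. \<bar>w\<bar>)" using env by (simp add: environment_def wealth_density_def)
  then show ?thesis by (rule integrable_abs_cancel) simp
qed

lemma menu: "\<beta> \<in> B \<Longrightarrow> integrable P \<beta>" "\<beta> \<in> B \<Longrightarrow> \<beta> \<in> borel_measurable borel" "(\<lambda>_. 0) \<in> B"
  and menu_compact: "compactin (L1_topology f) B"
proof -
  show i: "\<beta> \<in> B \<Longrightarrow> integrable P \<beta>" and "(\<lambda>_. 0) \<in> B" "compactin (L1_topology f) B"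
    using env by (auto simp: environment_def asset_menu_def assets_def)
  show "\<beta> \<in> B \<Longrightarrow> \<beta> \<in> borel_measurable borel"
    using borel_measurable_integrable[OF i] by simp
qed

lemma integrable_weighted:
  assumes "x \<in> X" "integrable P g"
  shows "integrable P (\<lambda>w. pmf (h w) x * g w)"
proof (rule Bochner_Integration.integrable_bound[OF assms(2)])
  show "(\<lambda>w. pmf (h w) x * g w) \<in> borel_measurable P"
    using pmf_measurable[OF assms(1)] borel_measurable_integrable[OF assms(2)] by simp
  show "AE w in P. norm (pmf (h w) x * g w) \<le> norm (g w)"
    by (auto simp: abs_mult pmf_le_1 intro!: mult_left_le_one_le)
qed

lemma sum_weighted_integrals:
  assumes "integrable P g"
  shows "(\<Sum>x\<in>X. \<integral>w. pmf (h w) x * g w \<partial>P) = (\<integral>w. g w \<partial>P)"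
proof -
  have "(\<Sum>x\<in>X. \<integral>w. pmf (h w) x * g w \<partial>P) = (\<integral>w. (\<Sum>x\<in>X. pmf (h w) x * g w) \<partial>P)"
    using integrable_weighted[OF _ assms] by (rule Bochner_Integration.integral_sum[symmetric])
  also have "\<dots> = (\<integral>w. g w \<partial>P)"
    by (simp add: sum_distrib_right[symmetric] sum_pmf)
  finally show ?thesis .
qed

lemma sum_signal_prob: "(\<Sum>x\<in>X. signal_prob f h x) = 1"
  using sum_weighted_integrals[of "\<lambda>_. 1"] P.prob_space by (simp add: signal_prob_def)

lemma utility_measurable: "u \<in> utilities f \<Longrightarrow> u \<in> borel_measurable borel"
  by (intro borel_measurable_continuous_onI utilities_continuous)

lemma utility_mono: "u \<in> utilities f \<Longrightarrow> strict_mono u"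
  and utility_integrable: "u \<in> utilities f \<Longrightarrow> integrable P u"
  by (auto simp: utilities_def)

lemma outcome_measurable:
  assumes "u \<in> utilities f" "b \<in> B"
  shows "(\<lambda>w. u (w + b w - \<mu>)) \<in> borel_measurable borel"
  using utility_measurable[OF assms(1)] menu(2)[OF assms(2)] by measurable

lemma weighted_outcome_measurable:
  assumes "u \<in> utilities f" "b \<in> B" "x \<in> X"
  shows "(\<lambda>w. pmf (h w) x * u (w + b w - \<mu>)) \<in> borel_measurable P"
  using outcome_measurable[OF assms(1,2)] pmf_measurable[OF assms(3)] by simp

text \<open>The majorant comes from linear growth. Its nonnegativity lets the same function bound
  the outcome and every version of it weighted by a probability.\<close>

lemma envelope:
  assumes "u \<in> utilities f" "b \<in> B"
  obtains p where "integrable P p" "\<And>w. 0 \<le> p w" "\<And>w. u (w + b w - \<mu>) \<le> p w"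
    "\<And>x w. pmf (h w) x * u (w + b w - \<mu>) \<le> p w"
proof -
  obtain C K where CK: "0 \<le> C" "0 \<le> K" "\<And>m. u m \<le> C + K * \<bar>m\<bar>"
    using utilities_linear_growth[OF assms(1)] by blast
  define p where "p w = C + K * \<bar>w + b w - \<mu>\<bar>" for w
  have nn: "0 \<le> p w" for w using CK by (simp add: p_def)
  have up: "u (w + b w - \<mu>) \<le> p w" for w using CK(3) by (simp add: p_def)
  have "pmf (h w) x * u (w + b w - \<mu>) \<le> p w" for x w
  proof -
    have "pmf (h w) x * u (w + b w - \<mu>) \<le> pmf (h w) x * p w" by (intro mult_left_mono up) simp
    also have "\<dots> \<le> p w" using nn by (simp add: pmf_le_1 mult_left_le_one_le)
    finally show ?thesis .
  qed
  moreover have "integrable P p"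
    unfolding p_def using integrable_wealth menu(1)[OF assms(2)] by auto
  ultimately show ?thesis using that nn up by blast
qed

lemma weighted_outcome_upper:
  assumes "u \<in> utilities f" "b \<in> B"
  shows "(\<integral>\<^sup>+w. ennreal (pmf (h w) x * u (w + b w - \<mu>)) \<partial>P) < \<infinity>"
proof -
  obtain p where p: "integrable P p" "\<And>x w. pmf (h w) x * u (w + b w - \<mu>) \<le> p w"
    by (rule envelope[OF assms, of \<mu>], rule that)
  show ?thesis by (rule nn_integral_finite_of_le[OF p])
qed

lemma signal_value_if:
  assumes "u \<in> utilities f" "b \<in> B" "x \<in> X"
  shows "val u \<mu> x b = (if integrable P (\<lambda>w. pmf (h w) x * u (w + b w - \<mu>))
     then ereal (\<integral>w. pmf (h w) x * u (w + b w - \<mu>) \<partial>P) else -\<infinity>)"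
  unfolding signal_value_def
  by (rule ext_integral_if[OF weighted_outcome_measurable[OF assms] weighted_outcome_upper[OF assms(1,2)]])

section \<open>Terminal wealth as an image measure\<close>

lemma nn_integral_terminal_law:
  assumes \<beta>: "\<beta> \<in> X \<rightarrow> B" and g[measurable]: "g \<in> borel_measurable borel"
  shows "(\<integral>\<^sup>+m. g m \<partial>law \<mu> \<beta>) = (\<Sum>x\<in>X. \<integral>\<^sup>+w. ennreal (pmf (h w) x) * g (w + \<beta> x w - \<mu>) \<partial>P)"
proof -
  have [measurable]: "(\<lambda>(x, w). ennreal (pmf (h w) x)) \<in> borel_measurable (count_space X \<Otimes>\<^sub>M P)"
    by (rule measurable_pair_measure_countable1)
      (use finite_X pmf_measurable in \<open>auto intro: countable_finite\<close>)
  have [measurable]: "(\<lambda>(x, w). w + \<beta> x w - \<mu>) \<in> borel_measurable (count_space X \<Otimes>\<^sub>M P)"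
    by (rule measurable_pair_measure_countable1)
      (use finite_X menu(2) funcset_mem[OF \<beta>] in \<open>auto intro: countable_finite\<close>)
  have "(\<integral>\<^sup>+m. g m \<partial>law \<mu> \<beta>)
      = (\<integral>\<^sup>+z. ennreal (pmf (h (snd z)) (fst z)) * g (snd z + \<beta> (fst z) (snd z) - \<mu>) \<partial>(count_space X \<Otimes>\<^sub>M P))"
    unfolding terminal_law_def
    by (subst nn_integral_distr) (auto simp: nn_integral_density split_beta)
  also have "\<dots> = (\<integral>\<^sup>+x. \<integral>\<^sup>+w. ennreal (pmf (h w) x) * g (w + \<beta> x w - \<mu>) \<partial>P \<partial>count_space X)"
    by (subst P.nn_integral_fst[symmetric]) (auto simp: split_beta')
  also have "\<dots> = (\<Sum>x\<in>X. \<integral>\<^sup>+w. ennreal (pmf (h w) x) * g (w + \<beta> x w - \<mu>) \<partial>P)"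
    by (rule nn_integral_count_space_finite[OF finite_X])
  finally show ?thesis .
qed

lemma emeasure_terminal_law:
  assumes \<beta>: "\<beta> \<in> X \<rightarrow> B" and A: "A \<in> sets borel"
  shows "emeasure (law \<mu> \<beta>) A = ennreal (\<Sum>x\<in>X. \<integral>w. pmf (h w) x * indicator A (w + \<beta> x w - \<mu>) \<partial>P)"
proof -
  have "emeasure (law \<mu> \<beta>) A = (\<integral>\<^sup>+m. indicator A m \<partial>law \<mu> \<beta>)"
    using A by (simp add: terminal_law_def)
  also have "\<dots> = (\<Sum>x\<in>X. \<integral>\<^sup>+w. ennreal (pmf (h w) x) * indicator A (w + \<beta> x w - \<mu>) \<partial>P)"
    using A by (intro nn_integral_terminal_law[OF \<beta>]) auto
  also have "\<dots> = (\<Sum>x\<in>X. ennreal (\<integral>w. pmf (h w) x * indicator A (w + \<beta> x w - \<mu>) \<partial>P))"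
  proof (rule sum.cong[OF refl])
    fix x assume x: "x \<in> X"
    have [measurable]: "\<beta> x \<in> borel_measurable borel" using menu(2) funcset_mem[OF \<beta> x] by blast
    have "integrable P (\<lambda>w. indicator A (w + \<beta> x w - \<mu>) :: real)"
      using A by (intro P.integrable_const_bound[where B=1]) auto
    from integrable_weighted[OF x this]
    have "(\<integral>\<^sup>+w. ennreal (pmf (h w) x * indicator A (w + \<beta> x w - \<mu>)) \<partial>P)
        = ennreal (\<integral>w. pmf (h w) x * indicator A (w + \<beta> x w - \<mu>) \<partial>P)"
      by (rule nn_integral_eq_integral) auto
    then show "(\<integral>\<^sup>+w. ennreal (pmf (h w) x) * indicator A (w + \<beta> x w - \<mu>) \<partial>P)
        = ennreal (\<integral>w. pmf (h w) x * indicator A (w + \<beta> x w - \<mu>) \<partial>P)"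
      by (simp add: ennreal_mult' ennreal_indicator)
  qed
  also have "\<dots> = ennreal (\<Sum>x\<in>X. \<integral>w. pmf (h w) x * indicator A (w + \<beta> x w - \<mu>) \<partial>P)"
    by (rule sum_ennreal) (auto intro!: integral_nonneg_AE)
  finally show ?thesis .
qed

lemma measure_terminal_law:
  assumes \<beta>: "\<beta> \<in> X \<rightarrow> B" and A: "A \<in> sets borel"
  shows "measure (law \<mu> \<beta>) A = (\<Sum>x\<in>X. \<integral>w. pmf (h w) x * indicator A (w + \<beta> x w - \<mu>) \<partial>P)"
  by (rule measure_eq_emeasure_eq_ennreal[OF _ emeasure_terminal_law[OF assms]])
    (auto intro!: sum_nonneg integral_nonneg_AE)

lemma distribution_terminal_law:
  assumes \<beta>: "\<beta> \<in> X \<rightarrow> B"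
  shows "real_distribution (law \<mu> \<beta>)"
proof -
  have "emeasure (law \<mu> \<beta>) UNIV = 1"
    by (subst emeasure_terminal_law[OF \<beta>])
      (use sum_signal_prob in \<open>simp_all add: signal_prob_def\<close>)
  then have "prob_space (law \<mu> \<beta>)"
    by (intro prob_spaceI) (simp add: terminal_law_def)
  then show ?thesis
    by (simp add: real_distribution_def real_distribution_axioms_def terminal_law_def)
qed

lemma terminal_cdf_eq:
  assumes \<beta>: "\<beta> \<in> X \<rightarrow> B"
  shows "terminal_cdf f X h \<mu> \<beta> = cdf (law \<mu> \<beta>)"
proof
  fix m
  have f[measurable]: "f \<in> borel_measurable borel" and f0: "\<And>w. 0 \<le> f w"
    using env by (auto simp: environment_def wealth_density_def)
  have "terminal_cdf f X h \<mu> \<beta> m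
      = (\<Sum>x\<in>X. \<integral>w. pmf (h w) x * indicator {..m} (w + \<beta> x w - \<mu>) \<partial>P)"
    unfolding terminal_cdf_def
  proof (rule sum.cong[OF refl])
    fix x assume x: "x \<in> X"
    note [measurable] = menu(2)[OF funcset_mem[OF \<beta> x]] pmf_measurable[OF x]
    let ?i = "indicator {w. w + \<beta> x w - \<mu> \<le> m} :: real \<Rightarrow> real"
    have m: "posterior_density f h x \<in> borel_measurable borel" "\<And>w. 0 \<le> posterior_density f h x w"
      unfolding posterior_density_def using signal_prob_pos[OF x] f0 by auto
    have "(\<integral>w. ?i w \<partial>wealth_law (posterior_density f h x)) = (\<integral>w. posterior_density f h x w * ?i w \<partial>lborel)"
      unfolding wealth_law_def using m by (subst integral_density) auto
    then have "signal_prob f h x * (\<integral>w. ?i w \<partial>wealth_law (posterior_density f h x))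
        = (\<integral>w. signal_prob f h x * (posterior_density f h x w * ?i w) \<partial>lborel)"
      by simp
    \<comment> \<open>The weight of the signal cancels the normalisation of the posterior, because
      every signal has positive probability.\<close>
    also have "\<dots> = (\<integral>w. f w * (pmf (h w) x * ?i w) \<partial>lborel)"
      using signal_prob_pos[OF x] by (intro Bochner_Integration.integral_cong) (auto simp: posterior_density_def)
    also have "\<dots> = (\<integral>w. pmf (h w) x * ?i w \<partial>P)"
      unfolding wealth_law_def using f0 by (subst integral_density) auto
    also have "\<dots> = (\<integral>w. pmf (h w) x * indicator {..m} (w + \<beta> x w - \<mu>) \<partial>P)"
      by (intro Bochner_Integration.integral_cong) (auto simp: indicator_def)
    finally show "signal_prob f h x * (\<integral>w. ?i w \<partial>wealth_law (posterior_density f h x))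
      = (\<integral>w. pmf (h w) x * indicator {..m} (w + \<beta> x w - \<mu>) \<partial>P)" .
  qed
  also have "\<dots> = cdf (law \<mu> \<beta>) m"
    unfolding cdf_def by (rule measure_terminal_law[OF \<beta>, symmetric]) simp
  finally show "terminal_cdf f X h \<mu> \<beta> m = cdf (law \<mu> \<beta>) m" .
qed

text \<open>A distribution on the line is determined by its distribution function, so the interval
  measure in \<open>max_expected_utility\<close> may be replaced by the image measure.\<close>

lemma interval_measure_terminal_cdf:
  assumes \<beta>: "\<beta> \<in> X \<rightarrow> B"
  shows "interval_measure (terminal_cdf f X h \<mu> \<beta>) = law \<mu> \<beta>"
proof -
  interpret L: real_distribution "law \<mu> \<beta>" by (rule distribution_terminal_law[OF \<beta>])
  note props = L.cdf_nondecreasing L.cdf_is_right_cont L.cdf_lim_at_bot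
  show ?thesis
    unfolding terminal_cdf_eq[OF \<beta>]
    by (rule cdf_unique[OF real_distribution_interval_measure[OF props L.cdf_lim_at_top_prob]
          L.real_distribution_axioms cdf_interval_measure[OF props]])
qed

lemma ext_integral_terminal_law:
  assumes \<beta>: "\<beta> \<in> X \<rightarrow> B" and u: "u \<in> utilities f"
  shows "ext_integral (law \<mu> \<beta>) u = (\<Sum>x\<in>X. val u \<mu> x (\<beta> x))"
    and "(\<integral>\<^sup>+m. ennreal (u m) \<partial>law \<mu> \<beta>) < \<infinity>"
proof -
  note [measurable] = utility_measurable[OF u]
  have eq: "(\<integral>\<^sup>+m. ennreal (u m) \<partial>law \<mu> \<beta>) = (\<Sum>x\<in>X. \<integral>\<^sup>+w. ennreal (pmf (h w) x * u (w + \<beta> x w - \<mu>)) \<partial>P)"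
    "(\<integral>\<^sup>+m. ennreal (- u m) \<partial>law \<mu> \<beta>) = (\<Sum>x\<in>X. \<integral>\<^sup>+w. ennreal (- (pmf (h w) x * u (w + \<beta> x w - \<mu>))) \<partial>P)"
    by (subst nn_integral_terminal_law[OF \<beta>]; simp add: ennreal_mult'[symmetric])+
  show "ext_integral (law \<mu> \<beta>) u = (\<Sum>x\<in>X. val u \<mu> x (\<beta> x))"
    unfolding ext_integral_def eq signal_value_def
    by (rule sum_enn2ereal_diff[OF finite_X]) (rule weighted_outcome_upper[OF u funcset_mem[OF \<beta>]])
  show "(\<integral>\<^sup>+m. ennreal (u m) \<partial>law \<mu> \<beta>) < \<infinity>"
    unfolding eq using weighted_outcome_upper[OF u funcset_mem[OF \<beta>]] finite_X by simp
qed

text \<open>No signal has value plus infinity, so a single value of minus infinity would pull down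
  the whole sum.\<close>

lemma strategy_value_finite:
  assumes \<beta>: "\<beta> \<in> X \<rightarrow> B" and u: "u \<in> utilities f"
    and fin: "-\<infinity> < (\<Sum>x\<in>X. val u \<mu> x (\<beta> x))"
  shows "x \<in> X \<Longrightarrow> integrable P (\<lambda>w. pmf (h w) x * u (w + \<beta> x w - \<mu>))"
    and "(\<Sum>x\<in>X. val u \<mu> x (\<beta> x)) = ereal (\<Sum>x\<in>X. \<integral>w. pmf (h w) x * u (w + \<beta> x w - \<mu>) \<partial>P)"
proof -
  have int: "integrable P (\<lambda>w. pmf (h w) x * u (w + \<beta> x w - \<mu>))" if x: "x \<in> X" for x
  proof (rule ccontr)
    assume "\<not> ?thesis"
    then have "val u \<mu> x (\<beta> x) = -\<infinity>" using signal_value_if[OF u funcset_mem[OF \<beta> x] x] by simp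
    then have "\<bar>\<Sum>x\<in>X. val u \<mu> x (\<beta> x)\<bar> = \<infinity>"
      using x finite_X unfolding sum_Inf by (auto intro!: bexI[of _ x])
    moreover have "val u \<mu> y (\<beta> y) \<noteq> \<infinity>" if "y \<in> X" for y
      using signal_value_if[OF u funcset_mem[OF \<beta> that] that] by simp
    then have "(\<Sum>x\<in>X. val u \<mu> x (\<beta> x)) \<noteq> \<infinity>" by (auto simp: sum_Pinfty)
    ultimately have "(\<Sum>x\<in>X. val u \<mu> x (\<beta> x)) = -\<infinity>" by auto
    with fin show False by simp
  qed
  show "x \<in> X \<Longrightarrow> integrable P (\<lambda>w. pmf (h w) x * u (w + \<beta> x w - \<mu>))" by (rule int)
  have "(\<Sum>x\<in>X. val u \<mu> x (\<beta> x)) = (\<Sum>x\<in>X. ereal (\<integral>w. pmf (h w) x * u (w + \<beta> x w - \<mu>) \<partial>P))"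
    by (rule sum.cong) (use signal_value_if[OF u funcset_mem[OF \<beta>]] int in auto)
  then show "(\<Sum>x\<in>X. val u \<mu> x (\<beta> x)) = ereal (\<Sum>x\<in>X. \<integral>w. pmf (h w) x * u (w + \<beta> x w - \<mu>) \<partial>P)"
    by simp
qed

section \<open>Dependence on the price\<close>

lemma signal_value_antimono:
  assumes "u \<in> utilities f" "\<mu> \<le> \<mu>'"
  shows "val u \<mu>' x b \<le> val u \<mu> x b"
  unfolding signal_value_def using utility_mono[OF assms(1)] assms(2)
  by (intro ext_integral_mono mult_left_mono) (auto simp: strict_mono_less_eq)

text \<open>Equal integrals would force the weights \<open>pmf (h w) x\<close> to vanish almost
  everywhere, against the positive probability of \<open>x\<close>. Integrability at the lower price
  follows by squeezing between the outcome at the higher price and the envelope.\<close>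

lemma signal_value_strict:
  assumes u: "u \<in> utilities f" and b: "b \<in> B" and x: "x \<in> X" and "\<mu> < \<mu>'"
    and int: "integrable P (\<lambda>w. pmf (h w) x * u (w + b w - \<mu>'))"
  shows "integrable P (\<lambda>w. pmf (h w) x * u (w + b w - \<mu>))"
    and "(\<integral>w. pmf (h w) x * u (w + b w - \<mu>') \<partial>P) < (\<integral>w. pmf (h w) x * u (w + b w - \<mu>) \<partial>P)"
proof -
  obtain p where p: "integrable P p" "\<And>x w. pmf (h w) x * u (w + b w - \<mu>) \<le> p w"
    by (rule envelope[OF u b, of \<mu>], rule that)
  have less: "u (w + b w - \<mu>') < u (w + b w - \<mu>)" for w
    using utility_mono[OF u] \<open>\<mu> < \<mu>'\<close> by (simp add: strict_mono_less)
  have le: "pmf (h w) x * u (w + b w - \<mu>') \<le> pmf (h w) x * u (w + b w - \<mu>)" for w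
    using less[of w] by (intro mult_left_mono) auto
  show int': "integrable P (\<lambda>w. pmf (h w) x * u (w + b w - \<mu>))"
    by (rule integrable_sandwich[OF int p(1) weighted_outcome_measurable[OF u b x] le p(2)])
  have "(\<integral>w. pmf (h w) x * u (w + b w - \<mu>') \<partial>P) \<le> (\<integral>w. pmf (h w) x * u (w + b w - \<mu>) \<partial>P)"
    by (rule integral_mono[OF int int' le])
  moreover have "(\<integral>w. pmf (h w) x * u (w + b w - \<mu>') \<partial>P) \<noteq> (\<integral>w. pmf (h w) x * u (w + b w - \<mu>) \<partial>P)"
  proof
    assume eq: "(\<integral>w. pmf (h w) x * u (w + b w - \<mu>') \<partial>P) = (\<integral>w. pmf (h w) x * u (w + b w - \<mu>) \<partial>P)"
    have "(\<integral>w. pmf (h w) x * u (w + b w - \<mu>) - pmf (h w) x * u (w + b w - \<mu>') \<partial>P) = 0"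
      using eq int int' by simp
    then have "AE w in P. pmf (h w) x * u (w + b w - \<mu>) - pmf (h w) x * u (w + b w - \<mu>') = 0"
      using le by (subst (asm) integral_nonneg_eq_0_iff_AE) (auto intro!: int int')
    then have "AE w in P. pmf (h w) x = 0"
    proof eventually_elim
      case (elim w)
      then have "pmf (h w) x * (u (w + b w - \<mu>) - u (w + b w - \<mu>')) = 0" by (simp add: algebra_simps)
      then show ?case using less[of w] by simp
    qed
    then have "signal_prob f h x = 0"
      unfolding signal_prob_def by (rule integral_eq_zero_AE)
    then show False using signal_prob_pos[OF x] by simp
  qed
  ultimately show "(\<integral>w. pmf (h w) x * u (w + b w - \<mu>') \<partial>P) < (\<integral>w. pmf (h w) x * u (w + b w - \<mu>) \<partial>P)"
    by simp
qed

end

section \<open>Optimal strategies and willingness to pay\<close>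

context risky_environment
begin

text \<open>Compactness in the form used below: a property that holds near each asset for some
  index, and persists as the index grows, holds on the whole menu for one index, the largest in a
  finite subcover. The indices will be utility levels and then prices.\<close>

lemma menu_compactness:
  fixes Q :: "'i::linorder \<Rightarrow> (real \<Rightarrow> real) \<Rightarrow> bool"
  assumes loc: "\<And>b. b \<in> B \<Longrightarrow> \<exists>i\<in>I. \<exists>r>0. \<forall>c\<in>B. L1_dist f b c < r \<longrightarrow> Q i c"
    and mono: "\<And>i j c. i \<le> j \<Longrightarrow> i \<in> I \<Longrightarrow> j \<in> I \<Longrightarrow> Q i c \<Longrightarrow> Q j c"
  shows "\<exists>i\<in>I. \<forall>c\<in>B. Q i c"
proof -
  define ball where "ball b r = {c \<in> assets f. L1_dist f b c < r}" for b r
  obtain i r where ir: "\<And>b. b \<in> B \<Longrightarrow> i b \<in> I \<and> 0 < r b \<and> (\<forall>c\<in>B. L1_dist f b c < r b \<longrightarrow> Q (i b) c)"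
    using loc by metis
  have BA: "B \<subseteq> assets f" using menu(1) by (auto simp: assets_def)
  have self: "L1_dist f b b = 0" for b by (simp add: L1_dist_def)
  have "openin (L1_topology f) (ball b r)" if "b \<in> assets f" for b r
    unfolding L1_topology_def ball_def using that by (intro topology_generated_by_Basis) auto
  then have "\<forall>U\<in>(\<lambda>b. ball b (r b)) ` B. openin (L1_topology f) U" using BA by blast
  moreover have "B \<subseteq> \<Union>((\<lambda>b. ball b (r b)) ` B)"
  proof
    fix b assume "b \<in> B"
    then have "b \<in> ball b (r b)" using BA ir by (auto simp: ball_def self)
    then show "b \<in> \<Union>((\<lambda>b. ball b (r b)) ` B)" using \<open>b \<in> B\<close> by blast
  qed
  ultimately obtain \<F> where \<F>: "finite \<F>" "\<F> \<subseteq> (\<lambda>b. ball b (r b)) ` B" "B \<subseteq> \<Union>\<F>"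
    using menu_compact unfolding compactin_def by meson
  obtain C where C: "finite C" "C \<subseteq> B" and "\<F> = (\<lambda>b. ball b (r b)) ` C"
    using finite_subset_image[OF \<F>(1,2)] by blast
  with \<F>(3) have cover: "B \<subseteq> (\<Union>b\<in>C. ball b (r b))" by simp
  \<comment> \<open>The zero asset belongs to the menu, so the subcover is nonempty and the maximum
    below is meaningful.\<close>
  have "C \<noteq> {}" using cover menu(3) by blast
  define j where "j = Max (i ` C)"
  have "j \<in> i ` C" unfolding j_def using C(1) \<open>C \<noteq> {}\<close> by (intro Max_in) auto
  then have jI: "j \<in> I" using ir C(2) by auto
  have "Q j c" if c: "c \<in> B" for c
  proof -
    obtain b where b: "b \<in> C" "c \<in> ball b (r b)" using cover c by blast
    have "Q (i b) c" "i b \<in> I" using ir[of b] b C(2) that by (auto simp: ball_def)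
    moreover have "i b \<le> j" unfolding j_def using b(1) C(1) by simp
    ultimately show ?thesis using mono jI by blast
  qed
  then show ?thesis using jI by blast
qed

text \<open>A counterexample sequence converges in L1, hence almost everywhere along a subsequence.
  Continuity of \<open>u\<close> and the Fatou argument then keep the bound in the limit, with the
  linear growth bounds at the assets of the sequence as majorants.\<close>

lemma signal_value_upper_semicontinuous:
  assumes u: "u \<in> utilities f" and b: "b \<in> B" and x: "x \<in> X" and less: "val u \<mu> x b < c"
  shows "\<exists>r>0. \<forall>b'\<in>B. L1_dist f b b' < r \<longrightarrow> val u \<mu> x b' < c"
proof (rule ccontr)
  assume neg: "\<not> ?thesis"
  have "\<exists>b'\<in>B. L1_dist f b b' < inverse (real (Suc n)) \<and> c \<le> val u \<mu> x b'" for n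
  proof (rule ccontr)
    assume "\<not> ?thesis"
    then have "\<forall>b'\<in>B. L1_dist f b b' < inverse (real (Suc n)) \<longrightarrow> val u \<mu> x b' < c"
      by (auto simp: not_le)
    moreover have "0 < inverse (real (Suc n))" by simp
    ultimately show False using neg by blast
  qed
  then obtain b' where b': "\<And>n. b' n \<in> B" "\<And>n. L1_dist f b (b' n) < inverse (real (Suc n))"
      "\<And>n. c \<le> val u \<mu> x (b' n)"
    by metis
  have bi: "integrable P b" "\<And>n. integrable P (b' n)" using menu(1) b b'(1) by auto
  have "(\<lambda>n. \<integral>w. norm (b w - b' n w) \<partial>P) \<longlonglongrightarrow> 0"
  proof (rule tendsto_sandwich[OF _ _ tendsto_const LIMSEQ_inverse_real_of_nat])
    show "\<forall>\<^sub>F n in sequentially. (\<integral>w. norm (b w - b' n w) \<partial>P) \<le> inverse (real (Suc n))"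
      using b'(2) by (intro always_eventually) (auto simp: L1_dist_def less_imp_le)
  qed simp
  then obtain r where r: "strict_mono (r :: nat \<Rightarrow> nat)" "AE w in P. (\<lambda>n. b w - b' (r n) w) \<longlonglongrightarrow> 0"
    and lim: "(\<lambda>n. \<integral>w. norm (b w - b' n w) \<partial>P) \<longlonglongrightarrow> 0"
    using tendsto_L1_AE_subseq[of P "\<lambda>n w. b w - b' n w"] bi by auto
  obtain C K where CK: "0 \<le> C" "0 \<le> K" "\<And>m. u m \<le> C + K * \<bar>m\<bar>"
    by (rule utilities_linear_growth[OF u], rule that)
  define p where "p b w = C + K * \<bar>w + b w - \<mu>\<bar>" for b :: "real \<Rightarrow> real" and w
  have p: "integrable P (p b)" if "integrable P b" for b
    unfolding p_def using that integrable_wealth by auto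
  have le: "pmf (h w) x * u (w + b w - \<mu>) \<le> p b w" for b w
  proof -
    have "0 \<le> p b w" using CK by (simp add: p_def)
    have "pmf (h w) x * u (w + b w - \<mu>) \<le> pmf (h w) x * p b w"
      unfolding p_def by (intro mult_left_mono CK(3)) simp
    also have "\<dots> \<le> p b w" using \<open>0 \<le> p b w\<close> by (simp add: pmf_le_1 mult_left_le_one_le)
    finally show ?thesis .
  qed
  have "c \<le> ext_integral P (\<lambda>w. pmf (h w) x * u (w + b w - \<mu>))"
  proof (rule ext_integral_limit_ge[where p = "p b" and p' = "\<lambda>n. p (b' (r n))"
        and g' = "\<lambda>n w. pmf (h w) x * u (w + b' (r n) w - \<mu>)"])
    show "AE w in P. (\<lambda>n. p (b' (r n)) w - pmf (h w) x * u (w + b' (r n) w - \<mu>))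
        \<longlonglongrightarrow> p b w - pmf (h w) x * u (w + b w - \<mu>)"
      using r(2)
    proof eventually_elim
      case (elim w)
      have "(\<lambda>n. b' (r n) w) \<longlonglongrightarrow> b w"
        using tendsto_diff[OF tendsto_const[of "b w"] elim] by simp
      then have l: "(\<lambda>n. w + b' (r n) w - \<mu>) \<longlonglongrightarrow> w + b w - \<mu>" by (intro tendsto_intros)
      have "isCont u (w + b w - \<mu>)"
        using utilities_continuous[OF u] by (simp add: continuous_on_eq_continuous_at)
      from isCont_tendsto_compose[OF this l]
      show ?case unfolding p_def by (intro tendsto_intros l)
    qed
    \<comment> \<open>The absolute value is 1-Lipschitz, so integrals of majorants differ by at most
      \<open>K\<close> times the L1 distance of the assets.\<close>
    show "(\<lambda>n. \<integral>w. p (b' (r n)) w \<partial>P) \<longlonglongrightarrow> (\<integral>w. p b w \<partial>P)"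
    proof (rule Lim_transform2[OF tendsto_const], rule Lim_null_comparison)
      have "(\<lambda>n. K * (\<integral>w. norm (b w - b' (r n) w) \<partial>P)) \<longlonglongrightarrow> K * 0"
        using LIMSEQ_subseq_LIMSEQ[OF lim r(1)] by (intro tendsto_intros) (simp add: o_def)
      then show "(\<lambda>n. K * (\<integral>w. norm (b w - b' (r n) w) \<partial>P)) \<longlonglongrightarrow> 0" by simp
      show "\<forall>\<^sub>F n in sequentially. norm ((\<integral>w. p b w \<partial>P) - (\<integral>w. p (b' (r n)) w \<partial>P))
          \<le> K * (\<integral>w. norm (b w - b' (r n) w) \<partial>P)"
      proof (intro always_eventually allI)
        fix n
        have i: "integrable P (\<lambda>w. p b w - p (b' (r n)) w)"
          using p[OF bi(1)] p[OF bi(2)] by auto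
        have "norm ((\<integral>w. p b w \<partial>P) - (\<integral>w. p (b' (r n)) w \<partial>P)) = norm (\<integral>w. p b w - p (b' (r n)) w \<partial>P)"
          using p[OF bi(1)] p[OF bi(2)] by simp
        also have "\<dots> \<le> (\<integral>w. norm (p b w - p (b' (r n)) w) \<partial>P)"
          by (rule integral_norm_bound)
        also have "\<dots> \<le> (\<integral>w. K * norm (b w - b' (r n) w) \<partial>P)"
        proof (rule integral_mono)
          fix w
          have "norm (p b w - p (b' (r n)) w) = K * \<bar>\<bar>w + b w - \<mu>\<bar> - \<bar>w + b' (r n) w - \<mu>\<bar>\<bar>"
            unfolding p_def using CK(2) by (simp add: abs_mult right_diff_distrib[symmetric])
          also have "\<dots> \<le> K * norm (b w - b' (r n) w)"
            using CK(2) by (intro mult_left_mono) (auto simp: abs_if)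
          finally show "norm (p b w - p (b' (r n)) w) \<le> K * norm (b w - b' (r n) w)" .
        qed (use i bi in auto)
        finally show "norm ((\<integral>w. p b w \<partial>P) - (\<integral>w. p (b' (r n)) w \<partial>P))
          \<le> K * (\<integral>w. norm (b w - b' (r n) w) \<partial>P)" by simp
      qed
    qed
    show "c \<le> ext_integral P (\<lambda>w. pmf (h w) x * u (w + b' (r n) w - \<mu>))" for n
      using b'(3)[of "r n"] by (simp add: signal_value_def)
  qed (use weighted_outcome_measurable[OF u _ x] b b'(1) p bi le in auto)
  then show False using less by (simp add: signal_value_def)
qed

text \<open>If no asset attained the supremum \<open>S\<close>, each would have a neighbourhood with
  values below some level less than \<open>S\<close>; compactness would give one such level for the
  whole menu.\<close>

lemma signal_value_attains_max:
  assumes u: "u \<in> utilities f" and x: "x \<in> X"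
  shows "\<exists>b\<in>B. \<forall>b'\<in>B. val u \<mu> x b' \<le> val u \<mu> x b"
proof (rule ccontr)
  assume neg: "\<not> ?thesis"
  define S where "S = (SUP b\<in>B. val u \<mu> x b)"
  have less: "val u \<mu> x b < S" if "b \<in> B" for b
  proof -
    obtain b' where b': "b' \<in> B" "val u \<mu> x b < val u \<mu> x b'" using neg \<open>b \<in> B\<close> by (auto simp: not_le)
    have "val u \<mu> x b' \<le> S" unfolding S_def using b'(1) by (rule SUP_upper)
    with b'(2) show ?thesis by (rule less_le_trans)
  qed
  have "\<exists>c\<in>{..<S}. \<forall>b\<in>B. val u \<mu> x b < c"
  proof (rule menu_compactness)
    fix b assume b: "b \<in> B"
    obtain c where c: "val u \<mu> x b < c" "c < S" using less[OF b] dense by blast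
    show "\<exists>c\<in>{..<S}. \<exists>r>0. \<forall>b'\<in>B. L1_dist f b b' < r \<longrightarrow> val u \<mu> x b' < c"
      using signal_value_upper_semicontinuous[OF u b x c(1)] c(2) by blast
  qed (rule less_le_trans)
  then obtain c where c: "c < S" "\<And>b. b \<in> B \<Longrightarrow> val u \<mu> x b < c" by blast
  have "S \<le> c" unfolding S_def by (rule SUP_least) (use c(2) in \<open>simp add: less_imp_le\<close>)
  with c(1) show False by simp
qed

text \<open>The value is a sum over signals and the asset is chosen freely after each one, so
  maximising signal by signal is optimal.\<close>

lemma
  assumes u: "u \<in> utilities f"
  shows max_expected_utility_attained: "\<exists>\<beta>\<in>X \<rightarrow> B. maxU u \<mu> = (\<Sum>x\<in>X. val u \<mu> x (\<beta> x))"
    and max_expected_utility_upper: "\<gamma> \<in> X \<rightarrow> B \<Longrightarrow> (\<Sum>x\<in>X. val u \<mu> x (\<gamma> x)) \<le> maxU u \<mu>"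
proof -
  have "\<forall>x\<in>X. \<exists>b. b \<in> B \<and> (\<forall>b'\<in>B. val u \<mu> x b' \<le> val u \<mu> x b)"
    using signal_value_attains_max[OF u] by blast
  from bchoice[OF this] obtain \<beta>
    where \<beta>: "\<forall>x\<in>X. \<beta> x \<in> B \<and> (\<forall>b'\<in>B. val u \<mu> x b' \<le> val u \<mu> x (\<beta> x))" ..
  have ext: "ext_integral (interval_measure (terminal_cdf f X h \<mu> \<gamma>)) u = (\<Sum>x\<in>X. val u \<mu> x (\<gamma> x))"
    if "\<gamma> \<in> X \<rightarrow> B" for \<gamma>
    unfolding interval_measure_terminal_cdf[OF that] by (rule ext_integral_terminal_law(1)[OF that u])
  have le: "(\<Sum>x\<in>X. val u \<mu> x (\<gamma> x)) \<le> (\<Sum>x\<in>X. val u \<mu> x (\<beta> x))" if "\<gamma> \<in> X \<rightarrow> B" for \<gamma>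
    using that \<beta> by (intro sum_mono) auto
  \<comment> \<open>The definition ranges over extensional strategies, whereas values depend only on
    the assets chosen at signals in \<open>X\<close>.\<close>
  have rB: "restrict \<beta> X \<in> X \<rightarrow>\<^sub>E B" using \<beta> by auto
  have eq: "maxU u \<mu> = (\<Sum>x\<in>X. val u \<mu> x (\<beta> x))"
    unfolding max_expected_utility_def
  proof (rule Greatest_equality)
    show "\<exists>\<gamma>\<in>X \<rightarrow>\<^sub>E B. (\<Sum>x\<in>X. val u \<mu> x (\<beta> x)) = ext_integral (interval_measure (terminal_cdf f X h \<mu> \<gamma>)) u"
    proof (rule bexI[OF _ rB])
      show "(\<Sum>x\<in>X. val u \<mu> x (\<beta> x)) = ext_integral (interval_measure (terminal_cdf f X h \<mu> (restrict \<beta> X))) u"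
        using ext[of "restrict \<beta> X"] rB by (simp add: PiE_def)
    qed
    fix y assume "\<exists>\<gamma>\<in>X \<rightarrow>\<^sub>E B. y = ext_integral (interval_measure (terminal_cdf f X h \<mu> \<gamma>)) u"
    then obtain \<gamma> where "\<gamma> \<in> X \<rightarrow> B" "y = ext_integral (interval_measure (terminal_cdf f X h \<mu> \<gamma>)) u"
      by (auto simp: PiE_def)
    then show "y \<le> (\<Sum>x\<in>X. val u \<mu> x (\<beta> x))" using ext le by simp
  qed
  then show "\<exists>\<beta>\<in>X \<rightarrow> B. maxU u \<mu> = (\<Sum>x\<in>X. val u \<mu> x (\<beta> x))" using \<beta> by auto
  show "\<gamma> \<in> X \<rightarrow> B \<Longrightarrow> (\<Sum>x\<in>X. val u \<mu> x (\<gamma> x)) \<le> maxU u \<mu>"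
    unfolding eq by (rule le)
qed

text \<open>The strategy that is optimal at the higher price is still available at the lower one and
  earns strictly more there.\<close>

lemma max_expected_utility_strict:
  assumes u: "u \<in> utilities f" and "\<mu> < \<mu>'" and fin: "-\<infinity> < maxU u \<mu>'"
  shows "maxU u \<mu>' < maxU u \<mu>"
proof -
  obtain \<beta> where \<beta>: "\<beta> \<in> X \<rightarrow> B" "maxU u \<mu>' = (\<Sum>x\<in>X. val u \<mu>' x (\<beta> x))"
    using max_expected_utility_attained[OF u, of \<mu>'] by blast
  have fin': "-\<infinity> < (\<Sum>x\<in>X. val u \<mu>' x (\<beta> x))" using fin \<beta>(2) by simp
  note int' = strategy_value_finite(1)[OF \<beta>(1) u fin']
  note strict = signal_value_strict[OF u funcset_mem[OF \<beta>(1)] _ \<open>\<mu> < \<mu>'\<close> int']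
  \<comment> \<open>Probabilities that sum to one need a signal; an empty sum would not increase
    strictly.\<close>
  have "X \<noteq> {}" using sum_pmf[of 0] by auto
  have "maxU u \<mu>' = ereal (\<Sum>x\<in>X. \<integral>w. pmf (h w) x * u (w + \<beta> x w - \<mu>') \<partial>P)"
    unfolding \<beta>(2) by (rule strategy_value_finite(2)[OF \<beta>(1) u fin'])
  also have "\<dots> < ereal (\<Sum>x\<in>X. \<integral>w. pmf (h w) x * u (w + \<beta> x w - \<mu>) \<partial>P)"
    using finite_X \<open>X \<noteq> {}\<close> strict(2) by (simp add: sum_strict_mono)
  also have "\<dots> = (\<Sum>x\<in>X. val u \<mu> x (\<beta> x))"
    using signal_value_if[OF u funcset_mem[OF \<beta>(1)]] strict(1) by simp
  also have "\<dots> \<le> maxU u \<mu>"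
    by (rule max_expected_utility_upper[OF u \<beta>(1)])
  finally show ?thesis .
qed

section \<open>Existence and uniqueness of the willingness to pay\<close>

lemma expected_utility_exceeds_value:
  assumes u: "u \<in> utilities f"
  obtains m where "u m < (\<integral>w. u w \<partial>P)"
proof -
  have "\<exists>m. u m < (\<integral>w. u w \<partial>P)"
  proof (rule ccontr)
    assume "\<not> ?thesis"
    then have le: "(\<integral>w. u w \<partial>P) \<le> u m" for m by (simp add: not_less)
    \<comment> \<open>Stepping one unit to the left makes the inequality strict; taking expectations
      then puts the mean strictly below itself.\<close>
    have "(\<integral>w. u w \<partial>P) < u m" for m
      using le[of "m - 1"] strict_monoD[OF utility_mono[OF u], of "m - 1" m] by simp
    then have "(\<integral>w. u w \<partial>P) < (\<integral>w. u w \<partial>P)"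
      by (intro P.expectation_greater utility_integrable[OF u]) auto
    then show False by simp
  qed
  then show ?thesis using that by blast
qed

text \<open>Pick \<open>m\<close> with \<open>u m\<close> below the mean of \<open>u\<close>. The
  excess of the outcome over \<open>u m\<close> tends to zero by dominated convergence as the price
  grows, and it eventually falls below the gap between the mean and \<open>u m\<close>.\<close>

lemma signal_value_eventually_small:
  assumes u: "u \<in> utilities f" and b: "b \<in> B" and x: "x \<in> X"
  shows "\<exists>n::nat. val u (real n) x b < ereal (signal_prob f h x * (\<integral>w. u w \<partial>P))"
proof -
  obtain m where m: "u m < (\<integral>w. u w \<partial>P)" by (rule expected_utility_exceeds_value[OF u])
  obtain p where p: "integrable P p" "\<And>w. 0 \<le> p w" "\<And>w. u (w + b w - 0) \<le> p w"
    by (rule envelope[OF u b, of 0], rule that)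
  note [measurable] = pmf_measurable[OF x] outcome_measurable[OF u b]
  define g where "g n w = pmf (h w) x * max 0 (u (w + b w - real n) - u m)" for n w
  have [measurable]: "g n \<in> borel_measurable P" for n unfolding g_def by measurable
  have dom: "norm (g n w) \<le> p w + \<bar>u m\<bar>" for n w
  proof -
    have "u (w + b w - real n) \<le> u (w + b w - 0)"
      using utility_mono[OF u] by (simp add: strict_mono_less_eq)
    then have "max 0 (u (w + b w - real n) - u m) \<le> p w + \<bar>u m\<bar>"
      using p(2,3)[of w] by auto
    moreover have "norm (g n w) \<le> max 0 (u (w + b w - real n) - u m)"
      unfolding g_def by (auto simp: abs_mult pmf_le_1 intro!: mult_left_le_one_le)
    ultimately show ?thesis by linarith
  qed
  have pi: "integrable P (\<lambda>w. p w + \<bar>u m\<bar>)" using p(1) by auto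
  have gi: "integrable P (g n)" for n
    by (rule Bochner_Integration.integrable_bound[OF pi]) (use dom p(2) in auto)
  have "(\<lambda>n. \<integral>w. g n w \<partial>P) \<longlonglongrightarrow> (\<integral>w. 0 \<partial>P)"
  proof (rule integral_dominated_convergence[OF _ _ pi])
    show "AE w in P. (\<lambda>n. g n w) \<longlonglongrightarrow> 0"
    proof (rule AE_I2)
      fix w
      obtain N :: nat where N: "w + b w - m \<le> real N" using real_arch_simple by blast
      show "(\<lambda>n. g n w) \<longlonglongrightarrow> 0"
      proof (rule tendsto_eventually, rule eventually_sequentiallyI[of N])
        fix n assume "N \<le> n"
        then have "w + b w - real n \<le> m" using N by simp
        then have "u (w + b w - real n) \<le> u m"
          using utility_mono[OF u] by (simp add: strict_mono_less_eq)
        then show "g n w = 0" by (simp add: g_def)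
      qed
    qed
  qed (use dom in auto)
  moreover have "0 < signal_prob f h x * ((\<integral>w. u w \<partial>P) - u m)"
    using signal_prob_pos[OF x] m by simp
  ultimately obtain n where n: "(\<integral>w. g n w \<partial>P) < signal_prob f h x * ((\<integral>w. u w \<partial>P) - u m)"
    using eventually_happens'[OF sequentially_bot order_tendstoD(2)] by fastforce
  have ki: "integrable P (\<lambda>w. pmf (h w) x * u m)" by (rule integrable_weighted[OF x]) simp
  have "val u (real n) x b \<le> ext_integral P (\<lambda>w. pmf (h w) x * u m + g n w)"
    unfolding signal_value_def
  proof (rule ext_integral_mono)
    fix w
    have "pmf (h w) x * u (w + b w - real n) \<le> pmf (h w) x * (u m + max 0 (u (w + b w - real n) - u m))"
      by (intro mult_left_mono) auto
    then show "pmf (h w) x * u (w + b w - real n) \<le> pmf (h w) x * u m + g n w"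
      by (simp add: g_def distrib_left)
  qed
  also have "\<dots> = ereal (\<integral>w. pmf (h w) x * u m + g n w \<partial>P)"
    using ki gi by (intro ext_integral_integrable) auto
  also have "(\<integral>w. pmf (h w) x * u m + g n w \<partial>P) = signal_prob f h x * u m + (\<integral>w. g n w \<partial>P)"
    using ki gi by (simp add: signal_prob_def)
  also have "ereal \<dots> < ereal (signal_prob f h x * (\<integral>w. u w \<partial>P))"
    using n by (simp add: right_diff_distrib)
  finally show ?thesis by blast
qed

text \<open>Compactness makes the price uniform over the menu, and the finitely many signals have a
  common one. The thresholds per signal add up to the mean of \<open>u\<close> because the signal
  probabilities sum to one.\<close>

lemma max_expected_utility_costly:
  assumes u: "u \<in> utilities f"
  shows "\<exists>\<mu>\<ge>0. maxU u \<mu> \<le> ext_integral P u"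
proof -
  have "\<exists>n\<in>UNIV. \<forall>b\<in>B. val u (real n) x b < ereal (signal_prob f h x * (\<integral>w. u w \<partial>P))" if x: "x \<in> X" for x
  proof (rule menu_compactness)
    fix b assume b: "b \<in> B"
    obtain n :: nat where "val u (real n) x b < ereal (signal_prob f h x * (\<integral>w. u w \<partial>P))"
      using signal_value_eventually_small[OF u b x] by blast
    from signal_value_upper_semicontinuous[OF u b x this]
    show "\<exists>n\<in>UNIV. \<exists>r>0. \<forall>c\<in>B. L1_dist f b c < r \<longrightarrow> val u (real n) x c < ereal (signal_prob f h x * (\<integral>w. u w \<partial>P))"
      by blast
  next
    fix i j :: nat and c
    assume "i \<le> j" "val u (real i) x c < ereal (signal_prob f h x * (\<integral>w. u w \<partial>P))"
    then show "val u (real j) x c < ereal (signal_prob f h x * (\<integral>w. u w \<partial>P))"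
      using signal_value_antimono[OF u, of "real i" "real j"] by (meson le_less_trans of_nat_mono)
  qed
  then obtain n where n: "\<And>x b. x \<in> X \<Longrightarrow> b \<in> B \<Longrightarrow>
      val u (real (n x)) x b < ereal (signal_prob f h x * (\<integral>w. u w \<partial>P))"
    by metis
  define N where "N = Max (n ` X)"
  obtain \<beta> where \<beta>: "\<beta> \<in> X \<rightarrow> B" "maxU u (real N) = (\<Sum>x\<in>X. val u (real N) x (\<beta> x))"
    using max_expected_utility_attained[OF u, of "real N"] by blast
  have "val u (real N) x (\<beta> x) \<le> ereal (signal_prob f h x * (\<integral>w. u w \<partial>P))" if x: "x \<in> X" for x
  proof -
    have "n x \<le> N" unfolding N_def using finite_X x by simp
    then have "val u (real N) x (\<beta> x) \<le> val u (real (n x)) x (\<beta> x)"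
      by (intro signal_value_antimono[OF u]) simp
    also have "\<dots> \<le> ereal (signal_prob f h x * (\<integral>w. u w \<partial>P))"
      using n[OF x funcset_mem[OF \<beta>(1) x]] by simp
    finally show ?thesis .
  qed
  then have "maxU u (real N) \<le> (\<Sum>x\<in>X. ereal (signal_prob f h x * (\<integral>w. u w \<partial>P)))"
    unfolding \<beta>(2) by (rule sum_mono)
  also have "\<dots> = ereal (\<integral>w. u w \<partial>P)"
    by (simp add: sum_distrib_right[symmetric] sum_signal_prob)
  also have "\<dots> = ext_integral P u"
    by (rule ext_integral_integrable[OF utility_integrable[OF u], symmetric])
  finally show ?thesis by (intro exI[of _ "real N"]) simp
qed

text \<open>The number is the infimum of the prices at which information brings no gain. Strict
  decrease in the price gives the strict inequality beyond it; two candidates would contradict each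
  other at any price between them.\<close>

lemma willingness_to_pay:
  assumes u: "u \<in> utilities f"
  shows "0 \<le> wtp u" and "wtp u < \<mu> \<Longrightarrow> maxU u \<mu> < ext_integral P u"
    and "0 \<le> \<mu> \<Longrightarrow> \<mu> < wtp u \<Longrightarrow> ext_integral P u < maxU u \<mu>"
proof -
  let ?W = "\<lambda>M. 0 \<le> M \<and> (\<forall>\<mu>>M. maxU u \<mu> < ext_integral P u) \<and>
    (\<forall>\<mu>. 0 \<le> \<mu> \<and> \<mu> < M \<longrightarrow> ext_integral P u < maxU u \<mu>)"
  define S where "S = {\<mu>. 0 \<le> \<mu> \<and> maxU u \<mu> \<le> ext_integral P u}"
  define M where "M = Inf S"
  have S: "S \<noteq> {}" "bdd_below S"
    using max_expected_utility_costly[OF u] by (auto simp: S_def intro: bdd_belowI[of _ 0])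
  have fin: "-\<infinity> < ext_integral P u" using ext_integral_integrable[OF utility_integrable[OF u]] by simp
  have W: "?W M"
  proof (intro conjI allI impI)
    show "0 \<le> M" unfolding M_def using S(1) by (intro cInf_greatest) (auto simp: S_def)
  next
    fix \<mu> assume "M < \<mu>"
    then obtain \<nu> where \<nu>: "\<nu> \<in> S" "\<nu> < \<mu>" using cInf_lessD[OF S(1)] unfolding M_def by blast
    then have le: "maxU u \<nu> \<le> ext_integral P u" by (simp add: S_def)
    show "maxU u \<mu> < ext_integral P u"
    \<comment> \<open>Strict decrease is known only if the maximum at the higher price exceeds minus
      infinity; otherwise the claim holds because the mean of \<open>u\<close> is finite.\<close>
    proof (cases "-\<infinity> < maxU u \<mu>")
      case True
      then show ?thesis using max_expected_utility_strict[OF u \<nu>(2)] le by simp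
    next
      case False
      then show ?thesis using fin by simp
    qed
  next
    fix \<mu> assume "0 \<le> \<mu> \<and> \<mu> < M"
    then have "\<mu> \<notin> S" using cInf_lower[OF _ S(2), of \<mu>] by (auto simp: M_def)
    then show "ext_integral P u < maxU u \<mu>" using \<open>0 \<le> \<mu> \<and> \<mu> < M\<close> by (simp add: S_def not_le)
  qed
  have uniq: "M' = M''" if "?W M'" "?W M''" for M' M''
  proof (rule ccontr)
    assume "M' \<noteq> M''"
    then consider "M' < M''" | "M'' < M'" by linarith
    then show False
    proof cases
      case 1
      then obtain \<mu> where "M' < \<mu>" "\<mu> < M''" using dense by blast
      moreover have "0 \<le> \<mu>" using that \<open>M' < \<mu>\<close> by simp
      ultimately show False using that by (meson less_asym)
    next
      case 2
      then obtain \<mu> where "M'' < \<mu>" "\<mu> < M'" using dense by blast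
      moreover have "0 \<le> \<mu>" using that \<open>M'' < \<mu>\<close> by simp
      ultimately show False using that by (meson less_asym)
    qed
  qed
  have "?W (wtp u)"
    unfolding willingness_to_pay_def by (rule theI[of ?W, OF W]) (rule uniq[OF _ W])
  then show "0 \<le> wtp u" "wtp u < \<mu> \<Longrightarrow> maxU u \<mu> < ext_integral P u"
    "0 \<le> \<mu> \<Longrightarrow> \<mu> < wtp u \<Longrightarrow> ext_integral P u < maxU u \<mu>"
    by blast+
qed

end

section \<open>Investment menus\<close>

text \<open>The menu's abstract ordering implies this concrete one when the pivot is a finite
  \<open>z\<close>. Being reflexive and transitive by its form, it replaces the abstract relation
  from here on.\<close>

definition steeper :: "real \<Rightarrow> (real \<Rightarrow> real) \<Rightarrow> (real \<Rightarrow> real) \<Rightarrow> bool" where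
  "steeper z b' b \<longleftrightarrow> (\<forall>w\<le>z. b' w \<le> b w) \<and> (\<forall>w\<ge>z. b w \<le> b' w)"

context risky_environment
begin

lemma density_f: "f \<in> borel_measurable borel" "0 \<le> f w"
  using env by (auto simp: environment_def wealth_density_def)

lemma mlr:
  "w \<le> w' \<Longrightarrow> x \<in> X \<Longrightarrow> x' \<in> X \<Longrightarrow> x \<le> x' \<Longrightarrow>
    pmf (h w) x' * pmf (h w') x \<le> pmf (h w) x * pmf (h w') x'"
  using is_experiment by (simp add: signal_experiment_def)

lemma cdf_P_eq: "cdf P m = (\<integral>w. f w * indicator {..m} w \<partial>lborel)"
proof -
  have "cdf P m = (\<integral>w. indicator {..m} w \<partial>P)" by (simp add: cdf_def)
  also have "\<dots> = (\<integral>w. f w * indicator {..m} w \<partial>lborel)"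
    unfolding wealth_law_def using density_f by (subst integral_density) auto
  finally show ?thesis .
qed

lemma cdf_P_below_support:
  assumes "\<And>w. w \<le> m \<Longrightarrow> f w = 0"
  shows "cdf P m = 0"
proof -
  have "(\<lambda>w. f w * indicator {..m} w) = (\<lambda>_. 0)"
  proof
    show "f w * indicator {..m} w = 0" for w using assms[of w] by (auto simp: indicator_def)
  qed
  then show ?thesis unfolding cdf_P_eq by simp
qed

lemma cdf_P_above_support:
  assumes "\<And>w. m < w \<Longrightarrow> f w = 0"
  shows "cdf P m = 1"
proof -
  have "1 = (\<integral>w. (1 :: real) \<partial>P)" using P.prob_space by simp
  also have "\<dots> = (\<integral>w. f w * 1 \<partial>lborel)"
    unfolding wealth_law_def using density_f by (subst integral_density) auto
  also have "(\<lambda>w. f w * 1) = (\<lambda>w. f w * indicator {..m} w)"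
  proof
    show "f w * 1 = f w * indicator {..m} w" for w
      using assms[of w] by (cases "w \<le> m") (auto simp: indicator_def)
  qed
  finally show ?thesis unfolding cdf_P_eq by simp
qed

section \<open>Terminal wealth under a strategy ordered by steepness\<close>

context
  fixes \<beta> :: "real \<Rightarrow> real \<Rightarrow> real" and z \<mu> :: real
  assumes lc: "log_concave f" and \<beta>: "\<beta> \<in> X \<rightarrow> B" and \<mu>: "0 \<le> \<mu>"
    and mono: "\<And>x. x \<in> X \<Longrightarrow> mono (\<beta> x)"
    and ordered: "\<And>x x'. x \<in> X \<Longrightarrow> x' \<in> X \<Longrightarrow> x \<le> x' \<Longrightarrow> steeper z (\<beta> x') (\<beta> x)"
    and above: "\<And>x. x \<in> X \<Longrightarrow> steeper z (\<beta> x) (\<lambda>_. 0)"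
begin

text \<open>At wealth below \<open>z\<close> no chosen asset has a positive payoff and the price is
  paid on top, so low wealth stays low.\<close>

lemma terminal_cdf_low:
  assumes "m \<le> z - \<mu>"
  shows "cdf P m \<le> cdf (law \<mu> \<beta>) m"
proof -
  have i: "integrable P (indicator {..m} :: real \<Rightarrow> real)"
    by (rule P.integrable_const_bound[where B=1]) auto
  have "cdf P m = (\<Sum>x\<in>X. \<integral>w. pmf (h w) x * indicator {..m} w \<partial>P)"
    using sum_weighted_integrals[OF i] by (simp add: cdf_def)
  also have "\<dots> \<le> (\<Sum>x\<in>X. \<integral>w. pmf (h w) x * indicator {..m} (w + \<beta> x w - \<mu>) \<partial>P)"
  proof (intro sum_mono integral_mono)
    fix x w assume x: "x \<in> X"
    note [measurable] = menu(2)[OF funcset_mem[OF \<beta> x]]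
    show "integrable P (\<lambda>w. pmf (h w) x * indicator {..m} w)" by (rule integrable_weighted[OF x i])
    have "integrable P (\<lambda>w. indicator {..m} (w + \<beta> x w - \<mu>) :: real)"
      by (rule P.integrable_const_bound[where B=1]) auto
    then show "integrable P (\<lambda>w. pmf (h w) x * indicator {..m} (w + \<beta> x w - \<mu>))"
      by (rule integrable_weighted[OF x])
    have "w + \<beta> x w - \<mu> \<le> m" if "w \<le> m"
    proof -
      have "w \<le> z" using that assms \<mu> by linarith
      then have "\<beta> x w \<le> 0" using above[OF x] by (simp add: steeper_def)
      then show ?thesis using that \<mu> by linarith
    qed
    then show "pmf (h w) x * indicator {..m} w \<le> pmf (h w) x * indicator {..m} (w + \<beta> x w - \<mu>)"
      by (auto simp: indicator_def)
  qed
  also have "\<dots> = cdf (law \<mu> \<beta>) m"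
    unfolding cdf_def by (rule measure_terminal_law[OF \<beta>, symmetric]) simp
  finally show ?thesis .
qed

definition tail_prob :: "real \<Rightarrow> real \<Rightarrow> real" where
  "tail_prob s w = (\<Sum>x\<in>{x \<in> X. s + \<mu> < \<beta> x w}. pmf (h w) x)"

text \<open>Two effects add up. Investments are nondecreasing, so the set of signals grows with
  wealth; and it is an upper set, so the MLR order raises its probability. For the upper set wealth
  must be at least \<open>z\<close>, where higher signals pay more; if \<open>s + \<mu>\<close> is
  nonnegative, a gain above it already forces this.\<close>

lemma tail_prob_mono:
  assumes "w \<le> w'" "0 \<le> s + \<mu> \<or> z \<le> w"
  shows "tail_prob s w \<le> tail_prob s w'"
proof -
  let ?U = "\<lambda>w. {x \<in> X. s + \<mu> < \<beta> x w}"
  have "x' \<in> ?U w" if "x \<in> ?U w" "x' \<in> X" "x \<le> x'" for x x'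
  proof -
    have "z \<le> w"
    proof (rule ccontr)
      assume "\<not> z \<le> w"
      then have "\<beta> x w \<le> 0" using above[of x] that by (simp add: steeper_def)
      then show False using that assms(2) \<open>\<not> z \<le> w\<close> by simp
    qed
    then have "\<beta> x w \<le> \<beta> x' w" using ordered[of x x'] that by (simp add: steeper_def)
    then show ?thesis using that by simp
  qed
  then have "tail_prob s w \<le> (\<Sum>x\<in>?U w. pmf (h w') x)"
    unfolding tail_prob_def by (intro MLR_upper_set[OF is_experiment assms(1)]) auto
  also have "\<dots> \<le> tail_prob s w'"
    unfolding tail_prob_def
  proof (rule sum_mono2)
    show "?U w \<subseteq> ?U w'" using monoD[OF mono assms(1)] by (force intro: less_le_trans)
  qed (use finite_X in auto)
  finally show ?thesis .
qed

lemma tail_prob_bounds: "0 \<le> tail_prob s w" "tail_prob s w \<le> 1"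
proof -
  show "0 \<le> tail_prob s w" unfolding tail_prob_def by (rule sum_nonneg) simp
  have "tail_prob s w \<le> (\<Sum>x\<in>X. pmf (h w) x)"
    unfolding tail_prob_def by (rule sum_mono2) (use finite_X in auto)
  then show "tail_prob s w \<le> 1" by (simp add: sum_pmf)
qed

text \<open>Here \<open>s = m - w\<close>. Divided by \<open>f m\<close>, the integrand is nondecreasing in \<open>m\<close>: log concavity
  takes care of \<open>f (m - s) / f m\<close>, and the MLR order of the probability of the signals under which
  the investment gains more than \<open>s\<close> net of the price. The proof multiplies by densities
  instead of dividing, since \<open>f\<close> may vanish.\<close>

lemma cdf_difference:
  defines "I m s \<equiv> f (m - s) * (tail_prob s (m - s) - (if s < 0 then 1 else 0))"
  shows "integrable lborel (I m)" "cdf P m - cdf (law \<mu> \<beta>) m = (\<integral>s. I m s \<partial>lborel)"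
proof -
  define T where "T w = (\<Sum>x\<in>X. pmf (h w) x * (indicator {..m} w - indicator {..m} (w + \<beta> x w - \<mu>)))" for w
  have ind: "integrable P (indicator {..m} :: real \<Rightarrow> real)"
    by (rule P.integrable_const_bound[where B=1]) auto
  have Ti: "integrable P T" "cdf P m - cdf (law \<mu> \<beta>) m = (\<integral>w. T w \<partial>P)"
  proof -
    have i: "integrable P (\<lambda>w. pmf (h w) x * indicator {..m} w)"
        "integrable P (\<lambda>w. pmf (h w) x * indicator {..m} (w + \<beta> x w - \<mu>))" if x: "x \<in> X" for x
    proof -
      note [measurable] = menu(2)[OF funcset_mem[OF \<beta> x]]
      have "integrable P (\<lambda>w. indicator {..m} (w + \<beta> x w - \<mu>) :: real)"
        by (rule P.integrable_const_bound[where B=1]) auto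
      then show "integrable P (\<lambda>w. pmf (h w) x * indicator {..m} (w + \<beta> x w - \<mu>))"
        by (rule integrable_weighted[OF x])
      show "integrable P (\<lambda>w. pmf (h w) x * indicator {..m} w)"
        by (rule integrable_weighted[OF x]) (rule ind)
    qed
    show "integrable P T" unfolding T_def right_diff_distrib using i by auto
    have "cdf P m = (\<Sum>x\<in>X. \<integral>w. pmf (h w) x * indicator {..m} w \<partial>P)"
      using sum_weighted_integrals[OF ind] by (simp add: cdf_def)
    moreover have "cdf (law \<mu> \<beta>) m = (\<Sum>x\<in>X. \<integral>w. pmf (h w) x * indicator {..m} (w + \<beta> x w - \<mu>) \<partial>P)"
      unfolding cdf_def by (rule measure_terminal_law[OF \<beta>]) simp
    moreover have "(\<integral>w. T w \<partial>P) = (\<Sum>x\<in>X. (\<integral>w. pmf (h w) x * indicator {..m} w \<partial>P)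
        - (\<integral>w. pmf (h w) x * indicator {..m} (w + \<beta> x w - \<mu>) \<partial>P))"
      unfolding T_def right_diff_distrib using i by (subst Bochner_Integration.integral_sum) auto
    ultimately show "cdf P m - cdf (law \<mu> \<beta>) m = (\<integral>w. T w \<partial>P)"
      by (simp add: sum_subtractf)
  qed
  have Tm: "T \<in> borel_measurable lborel"
    using borel_measurable_integrable[OF Ti(1)] by simp
  have fT: "integrable lborel (\<lambda>w. f w * T w)" "(\<integral>w. T w \<partial>P) = (\<integral>w. f w * T w \<partial>lborel)"
    using Ti(1) Tm density_f unfolding wealth_law_def
    by (simp_all add: integrable_density integral_density)
  have T_eq: "T (m - s) = tail_prob s (m - s) - (if s < 0 then 1 else 0)" for s
  proof -
    let ?w = "m - s"
    \<comment> \<open>Both indicators are rewritten through their complements: \<open>?w\<close>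
      exceeds \<open>m\<close> iff \<open>s < 0\<close>, and terminal wealth exceeds
      \<open>m\<close> iff the asset pays more than \<open>s + \<mu>\<close>.\<close>
    have 1: "indicator {..m} ?w - indicator {..m} (?w + \<beta> x ?w - \<mu>)
        = indicator {x. s + \<mu> < \<beta> x ?w} x - (if s < 0 then 1 else 0 :: real)" for x
      by (auto simp: indicator_def)
    have "T ?w = (\<Sum>x\<in>X. pmf (h ?w) x * indicator {x. s + \<mu> < \<beta> x ?w} x) - (\<Sum>x\<in>X. pmf (h ?w) x * (if s < 0 then 1 else 0))"
      unfolding T_def 1 right_diff_distrib by (rule sum_subtractf)
    also have "(\<Sum>x\<in>X. pmf (h ?w) x * indicator {x. s + \<mu> < \<beta> x ?w} x) = tail_prob s ?w"
      unfolding tail_prob_def sum.inter_filter[OF finite_X] by (intro sum.cong) auto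
    also have "(\<Sum>x\<in>X. pmf (h ?w) x * (if s < 0 then 1 else 0)) = (if s < 0 then 1 else 0)"
      using sum_pmf[of ?w] by simp
    finally show ?thesis .
  qed
  have I_eq: "I m s = f (m + - 1 * s) * T (m + - 1 * s)" for s
    using T_eq[of s] by (simp add: I_def)
  show "integrable lborel (I m)"
    unfolding I_eq[abs_def] using fT(1) by (rule lborel_integrable_real_affine) simp
  show "cdf P m - cdf (law \<mu> \<beta>) m = (\<integral>s. I m s \<partial>lborel)"
    unfolding I_eq Ti(2) fT(2)
    by (subst lborel_integral_real_affine[where c = "- 1" and t = m]) simp_all
qed

text \<open>With D the difference of the two distribution functions, integrating the pointwise
  comparison gives f(m') D(m) \<le> f(m) D(m'). So a positive D(m) rules out a negative D(m') as
  soon as f(m) > 0.\<close>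

lemma terminal_cdf_single_crossing:
  assumes "m < m'" and less: "cdf (law \<mu> \<beta>) m < cdf P m"
  shows "cdf (law \<mu> \<beta>) m' \<le> cdf P m'"
proof -
  interpret L: real_distribution "law \<mu> \<beta>" by (rule distribution_terminal_law[OF \<beta>])
  let ?D = "\<lambda>m. cdf P m - cdf (law \<mu> \<beta>) m"
  have mz: "z - \<mu> < m" using terminal_cdf_low[of m] less by linarith
  define I where "I m s = f (m - s) * (tail_prob s (m - s) - (if s < 0 then 1 else 0))" for m s
  note I = cdf_difference[folded I_def]
  have pointwise: "f m' * I m s \<le> f m * I m' s" for s
  proof (cases "s < 0")
    case False
    have fle: "f (m - s) * f m' \<le> f m * f (m' - s)"
      by (rule log_concave_four_points[OF lc density_f(2)]) (use False assms in auto)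
    have tle: "tail_prob s (m - s) \<le> tail_prob s (m' - s)"
      by (rule tail_prob_mono) (use False assms \<mu> in auto)
    have "f m' * I m s = (f (m - s) * f m') * tail_prob s (m - s)" using False by (simp add: I_def)
    also have "\<dots> \<le> (f m * f (m' - s)) * tail_prob s (m' - s)"
      by (intro mult_mono fle tle tail_prob_bounds mult_nonneg_nonneg density_f)
    also have "\<dots> = f m * I m' s" using False by (simp add: I_def)
    finally show ?thesis .
  next
    \<comment> \<open>Here the integrand is \<open>- f (m - s) * (1 - tail_prob s (m - s))\<close>.
      Relative to \<open>f m\<close> the density factor decreases in \<open>m\<close>, and so does
      the bracket; the sign reverses the inequality.\<close>
    case True
    have fle: "f m * f (m' - s) \<le> f m' * f (m - s)"
      by (rule log_concave_four_points[OF lc density_f(2)]) (use True assms in auto)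
    \<comment> \<open>If \<open>s + \<mu>\<close> is negative, then
      \<open>m - s > m + \<mu> > z\<close>, because \<open>mz\<close> places \<open>m\<close> above
      \<open>z - \<mu>\<close>.\<close>
    have tle: "tail_prob s (m - s) \<le> tail_prob s (m' - s)"
      by (rule tail_prob_mono) (use True assms mz in auto)
    have "(f m * f (m' - s)) * (1 - tail_prob s (m' - s)) \<le> (f m' * f (m - s)) * (1 - tail_prob s (m - s))"
      using tail_prob_bounds tle by (intro mult_mono fle mult_nonneg_nonneg density_f) auto
    then show ?thesis using True by (simp add: I_def algebra_simps)
  qed
  have "(\<integral>s. f m' * I m s \<partial>lborel) \<le> (\<integral>s. f m * I m' s \<partial>lborel)"
    by (rule integral_mono) (use I(1) pointwise in auto)
  then have main: "f m' * ?D m \<le> f m * ?D m'" using I by simp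
  show ?thesis
  proof (cases "0 < f m")
    case True
    have "0 \<le> f m * ?D m'" using main less density_f(2)[of m'] by (smt (verit) mult_nonneg_nonneg)
    then show ?thesis using True by (simp add: zero_le_mult_iff)
  next
    \<comment> \<open>Now \<open>m\<close> lies outside the interval where \<open>f\<close> is
      positive. As \<open>cdf P m\<close> is positive, that interval lies on the left of
      \<open>m\<close>, and all mass is below \<open>m'\<close>.\<close>
    case False
    have iv: "is_interval {w. 0 < f w}" using lc by (simp add: log_concave_def)
    have out: "f w = 0 \<or> f w' = 0" if "w \<le> m" "m \<le> w'" for w w'
    proof (rule ccontr)
      assume "\<not> ?thesis"
      then have "w \<in> {w. 0 < f w}" "w' \<in> {w. 0 < f w}"
        using density_f(2)[of w] density_f(2)[of w'] by auto
      then have "m \<in> {w. 0 < f w}" using iv that mem_is_interval_1_I by blast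
      then show False using False by simp
    qed
    have "\<exists>w\<le>m. f w \<noteq> 0"
    proof (rule ccontr)
      assume "\<not> ?thesis"
      then have "cdf P m = 0" by (intro cdf_P_below_support) auto
      then show False using less L.cdf_nonneg[of m] by simp
    qed
    then have "cdf P m' = 1"
      using out \<open>m < m'\<close> by (intro cdf_P_above_support) (meson less_imp_le order_trans)
    then show ?thesis using L.cdf_bounded_prob[of m'] by simp
  qed
qed

end

section \<open>Construction of an ordered strategy\<close>

lemma outcome_exchange:
  assumes u: "u \<in> utilities f" and b: "b \<in> B" and c: "c \<in> B" and x: "x \<in> X" and y: "y \<in> X" and "x \<le> y"
    and order: "steeper z b c" "steeper z c (\<lambda>_. 0)"
    and fin: "-\<infinity> < val u \<mu> x b" "-\<infinity> < val u \<mu> y c" and pref: "val u \<mu> x c < val u \<mu> x b"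
  shows "val u \<mu> y c \<le> val u \<mu> y b"
proof -
  obtain p1 where p1: "integrable P p1" "\<And>w. 0 \<le> p1 w" "\<And>w. u (w + b w - \<mu>) \<le> p1 w"
    by (rule envelope[OF u b, of \<mu>], rule that)
  obtain p2 where p2: "integrable P p2" "\<And>w. 0 \<le> p2 w" "\<And>w. u (w + c w - \<mu>) \<le> p2 w"
    by (rule envelope[OF u c, of \<mu>], rule that)
  have le: "u (w + b w - \<mu>) \<le> p1 w + p2 w" "u (w + c w - \<mu>) \<le> p1 w + p2 w" for w
    using p1(2,3)[of w] p2(2,3)[of w] by linarith+
  have umono: "u r \<le> u t" if "r \<le> t" for r t
    using utility_mono[OF u] that by (simp add: strict_mono_less_eq)
  have int: "integrable P (\<lambda>w. pmf (h w) x * u (w + b w - \<mu>))" "integrable P (\<lambda>w. pmf (h w) y * u (w + c w - \<mu>))"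
    using fin signal_value_if[OF u b x, of \<mu>] signal_value_if[OF u c y, of \<mu>] by (auto split: if_splits)
  have "integrable P (\<lambda>w. pmf (h w) y * u (w + b w - \<mu>)) \<and>
      (\<integral>w. pmf (h w) y * u (w + c w - \<mu>) \<partial>P) \<le> (\<integral>w. pmf (h w) y * u (w + b w - \<mu>) \<partial>P)"
  \<comment> \<open>On the right of \<open>z\<close> the asset \<open>c\<close> is nonnegative,
    which gives the lower bound \<open>u (z - \<mu>)\<close>; the sum of two nonnegative envelopes
    bounds both outcomes.\<close>
  proof (rule single_crossing_exchange[where z = z and l = "u (z - \<mu>)" and p = "\<lambda>w. p1 w + p2 w"
        and k = "\<lambda>w. pmf (h w) x"])
    show "pmf (h w) y * pmf (h t) x \<le> pmf (h w) x * pmf (h t) y" if "w \<le> t" for w t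
      by (rule mlr[OF that x y \<open>x \<le> y\<close>])
    show "u (w + b w - \<mu>) \<le> u (w + c w - \<mu>)" if "w \<le> z" for w
      using order(1) that by (intro umono) (simp add: steeper_def)
    show "u (w + c w - \<mu>) \<le> u (w + b w - \<mu>)" if "z \<le> w" for w
      using order(1) that by (intro umono) (simp add: steeper_def)
    show "u (z - \<mu>) \<le> u (w + c w - \<mu>)" if "z \<le> w" for w
    proof (rule umono)
      have "0 \<le> c w" using order(2) that by (simp add: steeper_def)
      then show "z - \<mu> \<le> w + c w - \<mu>" using that by simp
    qed
    show "(\<integral>w. pmf (h w) x * u (w + c w - \<mu>) \<partial>P) < (\<integral>w. pmf (h w) x * u (w + b w - \<mu>) \<partial>P)"
      if "integrable P (\<lambda>w. pmf (h w) x * u (w + c w - \<mu>))"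
      using pref that int(1) signal_value_if[OF u b x, of \<mu>] signal_value_if[OF u c x, of \<mu>] by simp
    show "finite_measure P" by unfold_locales
  qed (use int le p1(1) p2(1) pmf_measurable[OF x] pmf_measurable[OF y] outcome_measurable[OF u b]
      outcome_measurable[OF u c] in \<open>auto simp: pmf_le_1\<close>)
  then show ?thesis
    using signal_value_if[OF u b y, of \<mu>] signal_value_if[OF u c y, of \<mu>] int(2) by simp
qed

text \<open>Replies are sought only among the finitely many assets that \<open>\<gamma>\<close>
  uses. The sets of best replies are then finite, and no signal loses value because
  \<open>\<gamma> x\<close> is among the candidates.\<close>

lemma monotone_strategy:
  assumes u: "u \<in> utilities f" and \<gamma>: "\<gamma> \<in> X \<rightarrow> B" and fin: "-\<infinity> < (\<Sum>x\<in>X. val u \<mu> x (\<gamma> x))"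
    and total: "\<And>b c. b \<in> B \<Longrightarrow> c \<in> B \<Longrightarrow> steeper z b c \<or> steeper z c b"
    and above: "\<And>b. b \<in> B \<Longrightarrow> steeper z b (\<lambda>_. 0)"
  obtains \<beta> where "\<beta> \<in> X \<rightarrow> B" "(\<Sum>x\<in>X. val u \<mu> x (\<gamma> x)) \<le> (\<Sum>x\<in>X. val u \<mu> x (\<beta> x))"
    "\<And>x y. x \<in> X \<Longrightarrow> y \<in> X \<Longrightarrow> x \<le> y \<Longrightarrow> steeper z (\<beta> y) (\<beta> x)"
proof -
  define C where "C = \<gamma> ` X"
  have C: "finite C" "C \<subseteq> B" using finite_X \<gamma> by (auto simp: C_def)
  \<comment> \<open>The selection lemma needs a linearly ordered type, so an asset is replaced by
    its rank: the number of candidates that it is at least as steep as.\<close>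
  define r where "r b = card {c \<in> C. steeper z b c}" for b
  have r_le: "steeper z b c" if bc: "b \<in> C" "c \<in> C" "r c \<le> r b" for b c
  proof (rule ccontr)
    assume neg: "\<not> steeper z b c"
    then have "steeper z c b" using total bc C(2) by blast
    then have "{d \<in> C. steeper z b d} \<subseteq> {d \<in> C. steeper z c d}"
      by (auto simp: steeper_def intro: order_trans)
    moreover have "c \<in> {d \<in> C. steeper z c d}" "c \<notin> {d \<in> C. steeper z b d}"
      using bc neg by (auto simp: steeper_def)
    ultimately have "{d \<in> C. steeper z b d} \<subset> {d \<in> C. steeper z c d}" by blast
    then have "r b < r c" unfolding r_def using C(1) by (intro psubset_card_mono) auto
    then show False using bc(3) by simp
  qed
  define Opt where "Opt x = {b \<in> C. \<forall>c\<in>C. val u \<mu> x c \<le> val u \<mu> x b}" for x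
  have val_fin: "-\<infinity> < val u \<mu> x b" if "x \<in> X" "b \<in> Opt x" for x b
  proof -
    have "-\<infinity> < val u \<mu> x (\<gamma> x)"
      using strategy_value_finite(1)[OF \<gamma> u fin that(1)] signal_value_if[OF u funcset_mem[OF \<gamma> that(1)] that(1)]
      by simp
    also have "\<dots> \<le> val u \<mu> x b" using that by (auto simp: Opt_def C_def)
    finally show ?thesis .
  qed
  have ex: "finite (r ` Opt x) \<and> r ` Opt x \<noteq> {}" if "x \<in> X" for x
  proof -
    have "C \<noteq> {}" using that by (auto simp: C_def)
    then have "Max (val u \<mu> x ` C) \<in> val u \<mu> x ` C" using C(1) by (intro Max_in) auto
    then obtain b where "b \<in> C" "val u \<mu> x b = Max (val u \<mu> x ` C)" by auto
    then have "b \<in> Opt x" using C(1) by (auto simp: Opt_def)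
    then show ?thesis using C(1) by (auto simp: Opt_def)
  qed
  have swap: "i \<in> r ` Opt y \<or> j \<in> r ` Opt x"
    if "x \<in> X" "y \<in> X" "x < y" "i \<in> r ` Opt x" "j \<in> r ` Opt y" "j < i" for x y i j
  proof -
    obtain b c where b: "b \<in> Opt x" "i = r b" and c: "c \<in> Opt y" "j = r c" using \<open>i \<in> _\<close> \<open>j \<in> _\<close> by blast
    have bc: "b \<in> C" "c \<in> C" "b \<in> B" "c \<in> B" using b c C(2) by (auto simp: Opt_def)
    \<comment> \<open>Either \<open>x\<close> makes \<open>b\<close> strictly better than
      \<open>c\<close>, and this carries over weakly to \<open>y\<close>, or \<open>c\<close> ties
      with the best reply \<open>b\<close> at \<open>x\<close>. These are the two alternatives of
      the exchange condition.\<close>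
    have "c \<in> Opt x \<or> b \<in> Opt y"
    proof (cases "val u \<mu> x c < val u \<mu> x b")
      case True
      have "val u \<mu> y c \<le> val u \<mu> y b"
        by (rule outcome_exchange[OF u bc(3,4) that(1,2) less_imp_le[OF that(3)] r_le[OF bc(1,2)] above[OF bc(4)]
              val_fin[OF that(1) b(1)] val_fin[OF that(2) c(1)] True])
          (use \<open>j < i\<close> b c in simp)
      then show ?thesis using c(1) bc(1) unfolding Opt_def by (auto intro: order_trans)
    next
      case False
      then show ?thesis using b(1) bc(2) unfolding Opt_def by (auto simp: not_less intro: order_trans)
    qed
    then show ?thesis using b c by blast
  qed
  obtain s where s: "\<And>x. x \<in> X \<Longrightarrow> s x \<in> r ` Opt x" "\<And>x y. x \<in> X \<Longrightarrow> y \<in> X \<Longrightarrow> x \<le> y \<Longrightarrow> s x \<le> s y"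
    by (rule monotone_selection[OF finite_X, of "\<lambda>x. r ` Opt x", OF ex swap], assumption+, rule that)
  have "\<forall>x\<in>X. \<exists>b. b \<in> Opt x \<and> s x = r b" using s(1) by blast
  from bchoice[OF this] obtain \<beta> where \<beta>: "\<forall>x\<in>X. \<beta> x \<in> Opt x \<and> s x = r (\<beta> x)" ..
  show ?thesis
  proof (rule that)
    show "\<beta> \<in> X \<rightarrow> B" using \<beta> C(2) by (auto simp: Opt_def)
    show "(\<Sum>x\<in>X. val u \<mu> x (\<gamma> x)) \<le> (\<Sum>x\<in>X. val u \<mu> x (\<beta> x))"
      using \<beta> by (intro sum_mono) (auto simp: Opt_def C_def)
    show "steeper z (\<beta> y) (\<beta> x)" if "x \<in> X" "y \<in> X" "x \<le> y" for x y
      using r_le[of "\<beta> y" "\<beta> x"] s(2)[OF that] \<beta> that by (auto simp: Opt_def)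
  qed
qed

text \<open>For an asset that never loses, (ZAZI) forces equality of the means of
  \<open>u (w + b w)\<close> and \<open>u w\<close>, hence equality almost everywhere, and strict
  monotonicity gives \<open>b = 0\<close> there. So after any signal every asset leaves at most the
  initial wealth.\<close>

lemma no_value_under_dominance:
  assumes u: "u \<in> utilities f" and zazi: "ZAZI f B u" and "0 \<le> \<mu>"
    and sign: "\<And>b. b \<in> B \<Longrightarrow> (\<forall>w. b w \<le> 0) \<or> (\<forall>w. 0 \<le> b w)"
  shows "maxU u \<mu> \<le> ext_integral P u"
proof -
  have neg: "AE w in P. b w \<le> 0" if b: "b \<in> B" for b
  proof (cases "\<forall>w. b w \<le> 0")
    case False
    then have nn: "\<And>w. 0 \<le> b w" using sign[OF b] by blast
    have umono: "u r \<le> u t" if "r \<le> t" for r t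
      using utility_mono[OF u] that by (simp add: strict_mono_less_eq)
    obtain p where p: "integrable P p" "\<And>w. 0 \<le> p w" "\<And>w. u (w + b w - 0) \<le> p w"
      by (rule envelope[OF u b, of 0], rule that)
    note ui = utility_integrable[OF u]
    have le: "u w \<le> u (w + b w)" for w using nn[of w] by (intro umono) simp
    have i: "integrable P (\<lambda>w. u (w + b w))"
      by (rule integrable_sandwich[OF ui p(1)]) (use outcome_measurable[OF u b, of 0] le p(3) in auto)
    have "\<not> ext_integral P (\<lambda>w. u (w + b w)) > ext_integral P (\<lambda>w. u (w + 0))"
      using zazi b by (auto simp: ZAZI_def is_arg_max_def)
    then have "(\<integral>w. u (w + b w) \<partial>P) \<le> (\<integral>w. u w \<partial>P)"
      using ext_integral_integrable[OF i] ext_integral_integrable[OF ui] by simp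
    moreover have "(\<integral>w. u w \<partial>P) \<le> (\<integral>w. u (w + b w) \<partial>P)" by (rule integral_mono[OF ui i le])
    ultimately have "(\<integral>w. u (w + b w) - u w \<partial>P) = 0" using i ui by simp
    then have "AE w in P. u (w + b w) - u w = 0"
      using le by (subst (asm) integral_nonneg_eq_0_iff_AE) (auto intro!: i ui)
    then show ?thesis
    proof eventually_elim
      case (elim w)
      then have "u (w + b w) = u w" by simp
      then show ?case using utility_mono[OF u] by (simp add: strict_mono_eq)
    qed
  qed simp
  obtain \<gamma> where \<gamma>: "\<gamma> \<in> X \<rightarrow> B" "maxU u \<mu> = (\<Sum>x\<in>X. val u \<mu> x (\<gamma> x))"
    using max_expected_utility_attained[OF u, of \<mu>] by blast
  have "val u \<mu> x (\<gamma> x) \<le> ereal (\<integral>w. pmf (h w) x * u w \<partial>P)" if x: "x \<in> X" for x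
  proof -
    have "val u \<mu> x (\<gamma> x) \<le> ext_integral P (\<lambda>w. pmf (h w) x * u w)"
      unfolding signal_value_def
    proof (rule ext_integral_mono_AE)
      show "AE w in P. pmf (h w) x * u (w + \<gamma> x w - \<mu>) \<le> pmf (h w) x * u w"
        using neg[OF funcset_mem[OF \<gamma>(1) x]]
      proof eventually_elim
        case (elim w)
        then show ?case using \<open>0 \<le> \<mu>\<close> utility_mono[OF u]
          by (intro mult_left_mono) (auto simp: strict_mono_less_eq)
      qed
    qed
    then show ?thesis
      using ext_integral_integrable[OF integrable_weighted[OF x utility_integrable[OF u]]] by simp
  qed
  then have "maxU u \<mu> \<le> (\<Sum>x\<in>X. ereal (\<integral>w. pmf (h w) x * u w \<partial>P))"
    unfolding \<gamma>(2) by (rule sum_mono)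
  also have "\<dots> = ext_integral P u"
    using sum_weighted_integrals[OF utility_integrable[OF u]] ext_integral_integrable[OF utility_integrable[OF u]]
    by simp
  finally show ?thesis .
qed

lemma less_risk_averse_buys:
  assumes lc: "log_concave f" and u: "u \<in> utilities f" and v: "v \<in> utilities f" and ra: "more_risk_averse u v"
    and "0 \<le> \<mu>" and inv: "\<And>b. b \<in> B \<Longrightarrow> mono b"
    and total: "\<And>b c. b \<in> B \<Longrightarrow> c \<in> B \<Longrightarrow> steeper z b c \<or> steeper z c b"
    and buys: "ext_integral P u < maxU u \<mu>"
  shows "ext_integral P v \<le> maxU v \<mu>"
proof -
  have above: "steeper z b (\<lambda>_. 0)" if b: "b \<in> B" for b
  proof (rule disjE[OF total[OF b menu(3)]])
    \<comment> \<open>The reverse order forces \<open>b z = 0\<close>, and a nondecreasing function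
      vanishing at \<open>z\<close> is steeper than zero there.\<close>
    assume st: "steeper z (\<lambda>_. 0) b"
    have "b z = 0" using st by (force simp: steeper_def intro: antisym)
    then show ?thesis
      using monoD[OF inv[OF b], of _ z] monoD[OF inv[OF b], of z] by (simp add: steeper_def)
  qed
  note eu = ext_integral_integrable[OF utility_integrable[OF u]]
  note ev = ext_integral_integrable[OF utility_integrable[OF v]]
  obtain \<gamma> where \<gamma>: "\<gamma> \<in> X \<rightarrow> B" "maxU u \<mu> = (\<Sum>x\<in>X. val u \<mu> x (\<gamma> x))"
    using max_expected_utility_attained[OF u, of \<mu>] by blast
  have fin: "-\<infinity> < (\<Sum>x\<in>X. val u \<mu> x (\<gamma> x))"
    using buys eu \<gamma>(2) by (metis MInfty_neq_ereal(1) ereal_infty_less(2) less_ereal.simps(5) order_less_trans)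
  obtain \<beta> where \<beta>: "\<beta> \<in> X \<rightarrow> B" "(\<Sum>x\<in>X. val u \<mu> x (\<gamma> x)) \<le> (\<Sum>x\<in>X. val u \<mu> x (\<beta> x))"
    "\<And>x y. x \<in> X \<Longrightarrow> y \<in> X \<Longrightarrow> x \<le> y \<Longrightarrow> steeper z (\<beta> y) (\<beta> x)"
    by (rule monotone_strategy[OF u \<gamma>(1) fin total above], assumption+, rule that)
  interpret L: real_distribution "law \<mu> \<beta>" by (rule distribution_terminal_law[OF \<beta>(1)])
  note um = utility_measurable[OF u] and vm = utility_measurable[OF v]
  obtain \<phi> where \<phi>: "strict_mono \<phi>" "concave_on UNIV \<phi>" "u = \<phi> \<circ> v"
    using ra unfolding more_risk_averse_def by blast
  have less: "ext_integral P u < ext_integral (law \<mu> \<beta>) u"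
    using buys \<gamma>(2) \<beta>(2) ext_integral_terminal_law(1)[OF \<beta>(1) u] by simp
  have Lu: "integrable (law \<mu> \<beta>) u"
  proof (rule ccontr)
    assume "\<not> ?thesis"
    then have "ext_integral (law \<mu> \<beta>) u = -\<infinity>"
      by (intro ext_integral_not_integrable ext_integral_terminal_law(2)[OF \<beta>(1) u]) (use um in simp_all)
    then show False using less by simp
  qed
  have Lv: "integrable (law \<mu> \<beta>) v"
  proof -
    \<comment> \<open>A supporting line of \<open>\<phi>\<close> bounds \<open>v\<close> from below
      by an affine function of the integrable \<open>u\<close>; linear growth of \<open>v\<close>
      controls its positive part.\<close>
    obtain c where c: "0 < c" "\<And>t. \<phi> t \<le> \<phi> 0 + c * (t - 0)"
      by (rule concave_supergradient[OF \<phi>(1,2), of 0], rule that)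
    show ?thesis
    proof (rule integrable_sandwich)
      show "integrable (law \<mu> \<beta>) (\<lambda>m. (u m - \<phi> 0) / c)" using Lu by simp
      show "integrable (law \<mu> \<beta>) (\<lambda>m. max 0 (v m))"
      proof (rule integrableI_nonneg)
        have "ennreal (max 0 (v m)) = ennreal (v m)" for m by (simp add: max_def ennreal_neg)
        then show "(\<integral>\<^sup>+ m. ennreal (max 0 (v m)) \<partial>law \<mu> \<beta>) < \<infinity>"
          using ext_integral_terminal_law(2)[OF \<beta>(1) v, of \<mu>] by simp
      qed (use vm in auto)
      show "(u m - \<phi> 0) / c \<le> v m" for m
        using c(1) c(2)[of "v m"] by (simp add: \<phi>(3) divide_simps mult.commute)
    qed (use vm in auto)
  qed
  have "(\<integral>m. v m \<partial>P) \<le> (\<integral>m. v m \<partial>law \<mu> \<beta>)"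
  proof (rule single_crossing_preference[OF L.real_distribution_axioms distribution_P \<phi>])
    show "mono v" using utility_mono[OF v] by (rule strict_mono_mono)
    show "(\<integral>m. u m \<partial>P) < (\<integral>m. u m \<partial>law \<mu> \<beta>)"
      using less eu ext_integral_integrable[OF Lu] by simp
    have m: "mono (\<beta> x)" "steeper z (\<beta> x) (\<lambda>_. 0)" if "x \<in> X" for x
      using inv above funcset_mem[OF \<beta>(1) that] by auto
    note hyps = lc \<beta>(1) \<open>0 \<le> \<mu>\<close> m(1) \<beta>(3) m(2)
    show "cdf P m \<le> cdf (law \<mu> \<beta>) m" if "m \<le> z - \<mu>" for m
      by (rule terminal_cdf_low[OF hyps]) (use that in auto)
    show "cdf (law \<mu> \<beta>) m' \<le> cdf P m'" if "m < m'" "cdf (law \<mu> \<beta>) m < cdf P m" for m m'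
      by (rule terminal_cdf_single_crossing[OF hyps]) (use that in auto)
  qed (use utilities_continuous u v utility_integrable Lu Lv in auto)
  then have "ext_integral P v \<le> ext_integral (law \<mu> \<beta>) v"
    using ev ext_integral_integrable[OF Lv] by simp
  also have "\<dots> \<le> maxU v \<mu>"
    unfolding ext_integral_terminal_law(1)[OF \<beta>(1) v] by (rule max_expected_utility_upper[OF v \<beta>(1)])
  finally show ?thesis .
qed

end

theorem theorem1:
  fixes f :: "real \<Rightarrow> real" and B :: "(real \<Rightarrow> real) set"
    and X :: "real set" and h :: "real \<Rightarrow> real pmf"
    and u v :: "real \<Rightarrow> real"
  assumes "environment f B X h"
    and "log_concave f"
    and "investment_menu B"
    and "u \<in> utilities f" and "v \<in> utilities f"
    and "more_risk_averse u v"
    and "ZAZI f B u" and "ZAZI f B v"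
  shows "willingness_to_pay f B X h u \<le> willingness_to_pay f B X h v"
proof (rule ccontr)
  interpret risky_environment f B X h by unfold_locales fact
  note u = \<open>u \<in> utilities f\<close> and v = \<open>v \<in> utilities f\<close>
  assume "\<not> ?thesis"
  \<comment> \<open>At a price strictly in between \<open>v\<close> strictly loses, so even a weak
    inequality in favour of buying is a contradiction.\<close>
  then obtain \<mu> where \<mu>: "wtp v < \<mu>" "\<mu> < wtp u" using dense by (auto simp: not_le)
  have "0 \<le> \<mu>" using willingness_to_pay(1)[OF v] \<mu>(1) by simp
  have buys: "ext_integral P u < maxU u \<mu>" by (rule willingness_to_pay(3)[OF u \<open>0 \<le> \<mu>\<close> \<mu>(2)])
  have refuses: "maxU v \<mu> < ext_integral P v" by (rule willingness_to_pay(2)[OF v \<mu>(1)])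
  obtain wstar :: ereal and R where inv: "\<forall>b\<in>B. mono b"
    and total: "\<forall>b\<in>B. \<forall>b'\<in>B. R b' b \<or> R b b'"
    and R: "\<forall>b\<in>B. \<forall>b'\<in>B. R b' b \<longrightarrow>
       (\<forall>w. ereal w \<le> wstar \<longrightarrow> b' w \<le> b w) \<and> (\<forall>w. wstar \<le> ereal w \<longrightarrow> b w \<le> b' w)"
    using \<open>investment_menu B\<close> unfolding investment_menu_def by (elim exE conjE)
  note R = R[THEN bspec, THEN bspec, THEN mp] and total = total[THEN bspec, THEN bspec]
    and inv = inv[THEN bspec]
  show False
  proof (cases wstar)
    case (real z)
    have "steeper z b' b" if "b \<in> B" "b' \<in> B" "R b' b" for b b'
      using R[OF that] real by (simp add: steeper_def)
    then have "steeper z b c \<or> steeper z c b" if "b \<in> B" "c \<in> B" for b c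
      using total[OF that] that by blast
    from less_risk_averse_buys[OF \<open>log_concave f\<close> u v \<open>more_risk_averse u v\<close> \<open>0 \<le> \<mu>\<close> inv this buys]
    show False using refuses by simp
  next
    case PInf
    have "(\<forall>w. b w \<le> 0) \<or> (\<forall>w. 0 \<le> b w)" if "b \<in> B" for b
      using total[OF that menu(3)] R[OF that menu(3)] R[OF menu(3) that] PInf by auto
    from no_value_under_dominance[OF u \<open>ZAZI f B u\<close> \<open>0 \<le> \<mu>\<close> this] buys show False by simp
  next
    case MInf
    have "(\<forall>w. b w \<le> 0) \<or> (\<forall>w. 0 \<le> b w)" if "b \<in> B" for b
      using total[OF that menu(3)] R[OF that menu(3)] R[OF menu(3) that] MInf by auto
    from no_value_under_dominance[OF u \<open>ZAZI f B u\<close> \<open>0 \<le> \<mu>\<close> this] buys show False by simp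
  qed
qed

end
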